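(* Let $n\ge 1$. The number of $\mathbb{I}(n)$-preserving involutions of $\mathbb{M}\mathbb{C}(n)$ is $$\sum_{k=\lceil n/2\rceil}^{n}\Big(\prod_{j=1}^{k-1}\frac{2^n-2^j}{2^k-2^j}\Big)\Big(\prod_{j=0}^{n-k-1}(2^k-2^j)\Big)2^k,$$ where an empty product is understood to be equal to $1$.
   Context: The multicomplex numbers are defined recursively by $\mathbb{M}\mathbb{C}(0)=\mathbb{R}$ and $\mathbb{M}\mathbb{C}(n)=\{\eta_1+\eta_2\mathbf{i}_n:\eta_1,\eta_2\in\mathbb{M}\mathbb{C}(n-1)\}$ with $\mathbf{i}_n^2=-1$, where $\mathbf{i}_n$ is a new formal square root of $-1$ commuting with everything. Thus $\mathbb{M}\mathbb{C}(n)$ is a commutative unital real algebra of dimension $2^n$ generated by commuting units $\mathbf{i}_1,\dots,\mathbf{i}_n$ with $\mathbf{i}_k^2=-1$, with real basis $\mathbb{I}(n):=\{\mathbf{i}_1^{a_1}\cdots\mathbf{i}_n^{a_n}: a_k\in\{0,1\}\}$ (the $2^n$ monomials, including $1$). Put $\pm\mathbb{I}(n):=\{\pm\mathbf{i}:\mathbf{i}\in\mathbb{I}(n)\}$. An involution of a unital associative real algebra $A$ is an $\mathbb{R}$-linear map $f:A\to A$ with $f(\eta\zeta)=f(\eta)f(\zeta)$ and $f(f(\eta))=\eta$ for all $\eta,\zeta\in A$. An involution $f$ of $\mathbb{M}\mathbb{C}(n)$ is $\mathbb{I}(n)$-preserving if it maps every element of $\mathbb{I}(n)$ into $\pm\mathbb{I}(n)$.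 *)

theory Defs
  imports Complex_Main "HOL-Library.FuncSet" "HOL-Algebra.Module" "HOL-Algebra.Algebraic_Closure_Type"
begin

section \<open>Multicomplex numbers\<close>

text \<open>
  An element of level \<open>0\<close> is a real number; \<open>Adj a b\<close> stands for \<open>a + b i\<^sub>n\<close> with \<open>a\<close>, \<open>b\<close>
  of level \<open>n - 1\<close>. The datatype also contains pairs of mismatched levels; these lie in no
  \<open>mc_carrier n\<close>, and the operations below are left unspecified on arguments of different shapes.
\<close>

datatype mc = Base real | Adj mc mc

fun mc_carrier :: "nat \<Rightarrow> mc set" where
  "mc_carrier 0 = range Base"
| "mc_carrier (Suc n) = {Adj a b | a b. a \<in> mc_carrier n \<and> b \<in> mc_carrier n}"

fun mc_of_real :: "nat \<Rightarrow> real \<Rightarrow> mc" where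
  "mc_of_real 0 r = Base r"
| "mc_of_real (Suc n) r = Adj (mc_of_real n r) (mc_of_real n 0)"

fun mc_scale :: "real \<Rightarrow> mc \<Rightarrow> mc" where
  "mc_scale r (Base x) = Base (r * x)"
| "mc_scale r (Adj a b) = Adj (mc_scale r a) (mc_scale r b)"

fun mc_plus :: "mc \<Rightarrow> mc \<Rightarrow> mc" where
  "mc_plus (Base x) (Base y) = Base (x + y)"
| "mc_plus (Adj a b) (Adj c d) = Adj (mc_plus a c) (mc_plus b d)"

fun mc_times :: "mc \<Rightarrow> mc \<Rightarrow> mc" where
  "mc_times (Base x) (Base y) = Base (x * y)"
| "mc_times (Adj a b) (Adj c d) =
     Adj (mc_plus (mc_times a c) (mc_scale (- 1) (mc_times b d)))
         (mc_plus (mc_times a d) (mc_times b c))"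

definition MC :: "nat \<Rightarrow> (real, mc) module" where
  "MC n = \<lparr>carrier = mc_carrier n, monoid.mult = mc_times, one = mc_of_real n 1,
           zero = mc_of_real n 0, add = mc_plus, module.smult = mc_scale\<rparr>"

text \<open>
  \<open>mc_unit n k\<close> is \<open>i\<^sub>k\<close> viewed as an element of \<open>MC n\<close>, via the embeddings \<open>a \<mapsto> a + 0 i\<^sub>n\<close>.
  It is meaningful for \<open>1 \<le> k \<le> n\<close> only.
\<close>

fun mc_unit :: "nat \<Rightarrow> nat \<Rightarrow> mc" where
  "mc_unit (Suc n) k =
     (if k = Suc n then Adj (mc_of_real n 0) (mc_of_real n 1)
      else Adj (mc_unit n k) (mc_of_real n 0))"

definition mc_basis :: "nat \<Rightarrow> mc set" where
  "mc_basis n = {(\<Otimes>\<^bsub>MC n\<^esub>k\<in>{1..n}. mc_unit n k [^]\<^bsub>MC n\<^esub> a k) | a :: nat \<Rightarrow> nat.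
                   \<forall>k\<in>{1..n}. a k \<in> {0, 1}}"

definition mc_signed_basis :: "nat \<Rightarrow> mc set" where
  "mc_signed_basis n = mc_basis n \<union> (\<lambda>u. \<ominus>\<^bsub>MC n\<^esub> u) ` mc_basis n"


section \<open>Involutions\<close>

text \<open>
  A map on the algebra is represented by the function that is \<open>undefined\<close> outside the carrier
  (\<open>\<rightarrow>\<^sub>E\<close>), so that counting HOL functions counts maps \<open>A \<rightarrow> A\<close>.
\<close>

definition algebra_involution :: "(real, 'a) module \<Rightarrow> ('a \<Rightarrow> 'a) \<Rightarrow> bool" where
  "algebra_involution A f \<longleftrightarrow>
     f \<in> carrier A \<rightarrow>\<^sub>E carrier A \<and>
     (\<forall>x\<in>carrier A. \<forall>y\<in>carrier A. f (x \<oplus>\<^bsub>A\<^esub> y) = f x \<oplus>\<^bsub>A\<^esub> f y) \<and>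
     (\<forall>c. \<forall>x\<in>carrier A. f (c \<odot>\<^bsub>A\<^esub> x) = c \<odot>\<^bsub>A\<^esub> f x) \<and>
     (\<forall>x\<in>carrier A. \<forall>y\<in>carrier A. f (x \<otimes>\<^bsub>A\<^esub> y) = f x \<otimes>\<^bsub>A\<^esub> f y) \<and>
     (\<forall>x\<in>carrier A. f (f x) = x)"

definition basis_preserving_involutions :: "nat \<Rightarrow> (mc \<Rightarrow> mc) set" where
  "basis_preserving_involutions n =
     {f. algebra_involution (MC n) f \<and> f ` mc_basis n \<subseteq> mc_signed_basis n}"


section \<open>\<open>MC n\<close> is a commutative unital real algebra\<close>

lemma mc_of_real_closed: "mc_of_real n r \<in> mc_carrier n"
  by (induction n arbitrary: r) auto

lemma mc_scale_closed: "a \<in> mc_carrier n \<Longrightarrow> mc_scale r a \<in> mc_carrier n"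
  by (induction n arbitrary: a) auto

lemma mc_plus_closed:
  "\<lbrakk>a \<in> mc_carrier n; b \<in> mc_carrier n\<rbrakk> \<Longrightarrow> mc_plus a b \<in> mc_carrier n"
  by (induction n arbitrary: a b) fastforce+

lemma mc_times_closed:
  "\<lbrakk>a \<in> mc_carrier n; b \<in> mc_carrier n\<rbrakk> \<Longrightarrow> mc_times a b \<in> mc_carrier n"
proof (induction n arbitrary: a b)
  case (Suc n)
  then show ?case
    by (auto intro!: mc_plus_closed mc_scale_closed)
qed auto

lemma mc_plus_commute:
  "\<lbrakk>a \<in> mc_carrier n; b \<in> mc_carrier n\<rbrakk> \<Longrightarrow> mc_plus a b = mc_plus b a"
  by (induction n arbitrary: a b) fastforce+

lemma mc_plus_assoc:
  "\<lbrakk>a \<in> mc_carrier n; b \<in> mc_carrier n; c \<in> mc_carrier n\<rbrakk>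
    \<Longrightarrow> mc_plus (mc_plus a b) c = mc_plus a (mc_plus b c)"
  by (induction n arbitrary: a b c) fastforce+

lemma mc_plus_zero: "a \<in> mc_carrier n \<Longrightarrow> mc_plus (mc_of_real n 0) a = a"
  by (induction n arbitrary: a) auto

lemma mc_plus_minus: "a \<in> mc_carrier n \<Longrightarrow> mc_plus (mc_scale (- 1) a) a = mc_of_real n 0"
  by (induction n arbitrary: a) auto

lemma mc_scale_one: "a \<in> mc_carrier n \<Longrightarrow> mc_scale 1 a = a"
  by (induction n arbitrary: a) auto

lemma mc_scale_zero: "mc_scale r (mc_of_real n 0) = mc_of_real n 0"
  by (induction n) auto

lemma mc_zero_scale: "a \<in> mc_carrier n \<Longrightarrow> mc_scale 0 a = mc_of_real n 0"
  by (induction n arbitrary: a) auto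

lemma mc_scale_scale: "a \<in> mc_carrier n \<Longrightarrow> mc_scale r (mc_scale s a) = mc_scale (r * s) a"
  by (induction n arbitrary: a) auto

lemma mc_scale_add: "a \<in> mc_carrier n \<Longrightarrow> mc_scale (r + s) a = mc_plus (mc_scale r a) (mc_scale s a)"
  by (induction n arbitrary: a) (auto simp: algebra_simps)

lemma mc_scale_plus:
  "\<lbrakk>a \<in> mc_carrier n; b \<in> mc_carrier n\<rbrakk>
    \<Longrightarrow> mc_scale r (mc_plus a b) = mc_plus (mc_scale r a) (mc_scale r b)"
  by (induction n arbitrary: a b) (fastforce simp: algebra_simps)+

lemma mc_times_commute:
  "\<lbrakk>a \<in> mc_carrier n; b \<in> mc_carrier n\<rbrakk> \<Longrightarrow> mc_times a b = mc_times b a"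
proof (induction n arbitrary: a b)
  case (Suc n)
  then obtain p q r s where "a = Adj p q" "b = Adj r s"
    and *: "p \<in> mc_carrier n" "q \<in> mc_carrier n" "r \<in> mc_carrier n" "s \<in> mc_carrier n"
    by auto
  then show ?case
    using Suc.IH mc_plus_commute[of "mc_times p s" n "mc_times q r"]
    by (simp add: mc_times_closed)
qed (auto simp: mult.commute)

lemma mc_plus_left_commute:
  "\<lbrakk>a \<in> mc_carrier n; b \<in> mc_carrier n; c \<in> mc_carrier n\<rbrakk>
    \<Longrightarrow> mc_plus b (mc_plus a c) = mc_plus a (mc_plus b c)"
  by (metis mc_plus_assoc mc_plus_commute)

lemma mc_times_scale:
  "\<lbrakk>a \<in> mc_carrier n; b \<in> mc_carrier n\<rbrakk>
    \<Longrightarrow> mc_times (mc_scale r a) b = mc_scale r (mc_times a b)"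
proof (induction n arbitrary: a b)
  case (Suc n)
  then obtain p q u v where "a = Adj p q" "b = Adj u v"
    and *: "p \<in> mc_carrier n" "q \<in> mc_carrier n" "u \<in> mc_carrier n" "v \<in> mc_carrier n"
    by auto
  then show ?case
    using Suc.IH
    by (simp add: mc_times_closed mc_scale_closed mc_scale_plus[of _ n] mc_scale_scale[of _ n])
qed auto

lemma mc_distrib:
  "\<lbrakk>a \<in> mc_carrier n; b \<in> mc_carrier n; c \<in> mc_carrier n\<rbrakk>
    \<Longrightarrow> mc_times (mc_plus a b) c = mc_plus (mc_times a c) (mc_times b c)"
proof (induction n arbitrary: a b c)
  case (Suc n)
  then obtain p q u v x y where "a = Adj p q" "b = Adj u v" "c = Adj x y"
    and *: "p \<in> mc_carrier n" "q \<in> mc_carrier n" "u \<in> mc_carrier n" "v \<in> mc_carrier n"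
      "x \<in> mc_carrier n" "y \<in> mc_carrier n"
    by auto
  then show ?case
    using Suc.IH
    by (simp add: mc_times_closed mc_scale_closed mc_plus_closed mc_scale_plus[of _ n]
        mc_plus_assoc[of _ n] mc_plus_left_commute[of _ n])
qed (auto simp: algebra_simps)

lemma mc_distrib_right:
  "\<lbrakk>a \<in> mc_carrier n; b \<in> mc_carrier n; c \<in> mc_carrier n\<rbrakk>
    \<Longrightarrow> mc_times c (mc_plus a b) = mc_plus (mc_times c a) (mc_times c b)"
  by (metis mc_distrib mc_plus_closed mc_times_commute)

lemma mc_times_scale_right:
  "\<lbrakk>a \<in> mc_carrier n; b \<in> mc_carrier n\<rbrakk>
    \<Longrightarrow> mc_times a (mc_scale r b) = mc_scale r (mc_times a b)"
  by (metis mc_times_scale mc_scale_closed mc_times_commute)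

lemma mc_times_assoc:
  "\<lbrakk>a \<in> mc_carrier n; b \<in> mc_carrier n; c \<in> mc_carrier n\<rbrakk>
    \<Longrightarrow> mc_times (mc_times a b) c = mc_times a (mc_times b c)"
proof (induction n arbitrary: a b c)
  case (Suc n)
  then obtain p q u v x y where "a = Adj p q" "b = Adj u v" "c = Adj x y"
    and *: "p \<in> mc_carrier n" "q \<in> mc_carrier n" "u \<in> mc_carrier n" "v \<in> mc_carrier n"
      "x \<in> mc_carrier n" "y \<in> mc_carrier n"
    by auto
  then show ?case
    using Suc.IH
    by (simp add: mc_times_closed mc_scale_closed mc_plus_closed mc_scale_plus[of _ n]
        mc_distrib[of _ n] mc_distrib_right[of _ n] mc_times_scale[of _ n]
        mc_times_scale_right[of _ n] mc_plus_assoc[of _ n] mc_plus_left_commute[of _ n]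
        mc_plus_commute[of _ n])
qed auto

lemma mc_times_zero:
  "a \<in> mc_carrier n \<Longrightarrow> mc_times (mc_of_real n 0) a = mc_of_real n 0"
  by (induction n arbitrary: a) (auto simp: mc_scale_zero mc_plus_zero mc_of_real_closed)

lemma mc_times_one: "a \<in> mc_carrier n \<Longrightarrow> mc_times (mc_of_real n 1) a = a"
proof (induction n arbitrary: a)
  case (Suc n)
  then obtain p q where "a = Adj p q" "p \<in> mc_carrier n" "q \<in> mc_carrier n"
    by auto
  then show ?case
    using Suc.IH mc_plus_commute[OF _ mc_of_real_closed, of _ n 0]
    by (simp add: mc_times_zero mc_scale_zero mc_plus_zero)
qed auto

lemma MC_cring: "cring (MC n)"
proof (rule cringI)
  show "abelian_group (MC n)"
  proof (rule abelian_groupI)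
    fix x assume "x \<in> carrier (MC n)"
    then show "\<exists>y\<in>carrier (MC n). y \<oplus>\<^bsub>MC n\<^esub> x = \<zero>\<^bsub>MC n\<^esub>"
      by (auto simp: MC_def intro!: bexI[of _ "mc_scale (- 1) x"] mc_plus_minus mc_scale_closed)
  qed (auto simp: MC_def mc_of_real_closed mc_plus_closed mc_plus_zero
      intro: mc_plus_assoc mc_plus_commute)
  show "comm_monoid (MC n)"
    by (rule comm_monoidI)
      (auto simp: MC_def mc_of_real_closed mc_times_closed mc_times_one
        intro: mc_times_assoc mc_times_commute)
qed (auto simp: MC_def intro: mc_distrib)

lemma MC_algebra: "algebra (ring_of_type_algebra :: real ring) (MC n)"
  by (rule algebraI[OF cring_from_type_algebra MC_cring])
    (auto simp: MC_def ring_of_type_algebra_def mc_scale_closed mc_scale_one mc_scale_scale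
      intro: mc_scale_add mc_scale_plus mc_times_scale)

lemma MC_Suc_decompose:
  assumes "a \<in> mc_carrier n" "b \<in> mc_carrier n"
  shows "Adj a b = Adj a (mc_of_real n 0) \<oplus>\<^bsub>MC (Suc n)\<^esub>
           (Adj b (mc_of_real n 0) \<otimes>\<^bsub>MC (Suc n)\<^esub> mc_unit (Suc n) (Suc n))"
proof -
  have "mc_times b (mc_of_real n 0) = mc_of_real n 0" "mc_times b (mc_of_real n 1) = b"
    using assms by (metis mc_of_real_closed mc_times_commute mc_times_zero mc_times_one)+
  moreover have "mc_plus x (mc_of_real n 0) = x" if "x \<in> mc_carrier n" for x
    using that by (metis mc_of_real_closed mc_plus_commute mc_plus_zero)
  ultimately show ?thesis
    using assms by (simp add: MC_def mc_scale_zero mc_plus_zero mc_times_zero mc_of_real_closed)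
qed

lemma mc_unit_closed: "\<lbrakk>1 \<le> k; k \<le> n\<rbrakk> \<Longrightarrow> mc_unit n k \<in> carrier (MC n)"
  by (induction n) (auto simp: MC_def mc_of_real_closed)

lemma mc_unit_square:
  "\<lbrakk>1 \<le> k; k \<le> n\<rbrakk> \<Longrightarrow> mc_unit n k \<otimes>\<^bsub>MC n\<^esub> mc_unit n k = \<ominus>\<^bsub>MC n\<^esub> \<one>\<^bsub>MC n\<^esub>"
proof -
  assume k: "1 \<le> k" "k \<le> n"
  then have "mc_times (mc_unit n k) (mc_unit n k) = mc_scale (- 1) (mc_of_real n 1)"
  proof (induction n)
    case (Suc n)
    have plus0: "mc_plus x (mc_of_real n 0) = x" if "x \<in> mc_carrier n" for x
      using that by (metis mc_of_real_closed mc_plus_commute mc_plus_zero)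
    show ?case
    proof (cases "k = Suc n")
      case True
      then show ?thesis
        by (simp add: mc_times_zero mc_times_one mc_plus_zero mc_scale_zero mc_scale_closed
            mc_of_real_closed mc_times_commute[of "mc_of_real n 1" n "mc_of_real n 0"])
    next
      case False
      then have "k \<le> n" "mc_unit n k \<in> mc_carrier n"
        using Suc.prems mc_unit_closed[of k n] by (auto simp: MC_def)
      then show ?thesis
        using Suc False
        by (simp add: mc_times_zero mc_plus_zero mc_scale_zero mc_scale_closed plus0
            mc_of_real_closed mc_times_commute[of "mc_unit n k" n "mc_of_real n 0"])
    qed
  qed auto
  moreover interpret cring "MC n" by (rule MC_cring)
  have "mc_scale (- 1) (mc_of_real n 1) = \<ominus>\<^bsub>MC n\<^esub> \<one>\<^bsub>MC n\<^esub>"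
    by (rule minus_equality[symmetric])
      (auto simp: MC_def mc_plus_minus mc_of_real_closed mc_scale_closed)
  ultimately show ?thesis
    by (simp add: MC_def)
qed

end

theory Submission
  imports Defs
begin

text \<open>
  An algebra map is determined by its values on the signed monomials, and these form a finite abelian
  group \<open>S\<close> of order \<open>2\<^sup>n\<^sup>+\<^sup>1\<close> in which every square is \<open>1\<close> or \<open>-1\<close>. An involution that preserves the
  signed monomials therefore restricts to an involutive automorphism of \<open>S\<close> fixing \<open>-1\<close>, and
  conversely each such automorphism extends linearly to an involution of the algebra: the monomials
  are a basis, and multiplicativity only has to be checked on them.

  Let \<open>T\<close> be the subgroup of the signed monomials with square \<open>1\<close>, an elementary abelian 2-group
  containing \<open>-1\<close>. Multiplication by \<open>i\<^sub>1\<close> swaps \<open>T\<close> with its complement in \<open>S\<close>, so \<open>T\<close> has order \<open>2\<^sup>n\<close>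
  and an involution \<open>f\<close> is determined by its restriction \<open>g\<close> to \<open>T\<close> and by the element \<open>t\<close> of \<open>T\<close> with
  \<open>f(i\<^sub>1) = i\<^sub>1 t\<close>. From \<open>f(f(i\<^sub>1)) = i\<^sub>1 t g(t)\<close> the condition on \<open>t\<close> is \<open>g(t) = t\<close>. So the number of
  involutions is the sum, over the involutive automorphisms \<open>g\<close> of \<open>T\<close> that fix \<open>-1\<close>, of the number of
  fixed points of \<open>g\<close> (\<open>card_basis_preserving_involutions\<close>). The factor \<open>2\<^sup>k\<close> of the formula counts the
  choices of \<open>t\<close> when \<open>g\<close> has \<open>2\<^sup>k\<close> fixed points.

  It remains to count the \<open>g\<close> with \<open>2\<^sup>k\<close> fixed points (\<open>card_involutions_by_fixed_points\<close>). View \<open>T\<close>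
  as a vector space over the field with two elements, of dimension \<open>n\<close>. The displacement map
  \<open>x \<mapsto> x g(x)\<close> is linear, its kernel is the space of fixed points, and its range lies in this kernel.
  Choosing \<open>g\<close> thus amounts to choosing a \<open>k\<close>-dimensional kernel through \<open>-1\<close> and an injection of
  the quotient by it into it. Instead of quotients, the proof counts the pairs of \<open>g\<close> and a basis of \<open>T\<close>
  adapted to it, i.e. one that starts with a basis of the fixed points starting with \<open>-1\<close>; such a pair
  is the same as a basis starting with \<open>-1\<close> together with independent displacements of its last
  \<open>n - k\<close> vectors, taken from the span of the first \<open>k\<close>. There can be no such displacements
  if \<open>2k < n\<close>, which is why the sum starts at \<open>n/2\<close>, rounded up.
\<close>

section \<open>Spans and independence in elementary abelian 2-groups\<close>

locale elementary_abelian_2_group = comm_group G for G (structure) +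
  assumes square_one: "x \<in> carrier G \<Longrightarrow> x \<otimes> x = \<one>"
begin

lemma cancel_twice: "\<lbrakk>x \<in> carrier G; y \<in> carrier G\<rbrakk> \<Longrightarrow> x \<otimes> (x \<otimes> y) = y"
  by (metis l_one m_assoc square_one)

lemma mult_eq_one_iff: "\<lbrakk>x \<in> carrier G; y \<in> carrier G\<rbrakk> \<Longrightarrow> x \<otimes> y = \<one> \<longleftrightarrow> x = y"
  by (metis cancel_twice r_one square_one)

text \<open>
  Lists instead of sets keep track of the order in which a basis is chosen, and each element of a span
  arises by multiplying together some of the entries of the list, since scalars are \<open>0\<close> or \<open>1\<close>.
\<close>

primrec list_span :: "'a list \<Rightarrow> 'a set" where
  "list_span [] = {\<one>}"
| "list_span (v # vs) = list_span vs \<union> (\<lambda>x. v \<otimes> x) ` list_span vs"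

primrec indep :: "'a list \<Rightarrow> bool" where
  "indep [] \<longleftrightarrow> True"
| "indep (v # vs) \<longleftrightarrow> v \<notin> list_span vs \<and> indep vs"

lemma finite_list_span: "finite (list_span vs)"
  by (induction vs) auto

lemma one_in_list_span: "\<one> \<in> list_span vs"
  by (induction vs) auto

lemma list_span_closed: "set vs \<subseteq> carrier G \<Longrightarrow> list_span vs \<subseteq> carrier G"
  by (induction vs) auto

lemma set_subset_list_span: "set vs \<subseteq> carrier G \<Longrightarrow> set vs \<subseteq> list_span vs"
proof (induction vs)
  case (Cons v vs)
  have "v = v \<otimes> \<one>" using Cons.prems by simp
  then have "v \<in> (\<lambda>x. v \<otimes> x) ` list_span vs" using one_in_list_span by (rule image_eqI)
  then show ?case using Cons by auto
qed simp

lemma list_span_mult: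
  "\<lbrakk>set vs \<subseteq> carrier G; x \<in> list_span vs; y \<in> list_span vs\<rbrakk> \<Longrightarrow> x \<otimes> y \<in> list_span vs"
proof (induction vs arbitrary: x y)
  case (Cons v vs)
  have v: "v \<in> carrier G" and vs: "set vs \<subseteq> carrier G" using Cons.prems by auto
  have IH: "a \<otimes> b \<in> list_span vs" if "a \<in> list_span vs" "b \<in> list_span vs" for a b
    using Cons.IH[OF vs that] .
  have mixed: "v \<otimes> a \<otimes> b = v \<otimes> (a \<otimes> b)" "a \<otimes> (v \<otimes> b) = v \<otimes> (a \<otimes> b)"
    "v \<otimes> a \<otimes> (v \<otimes> b) = a \<otimes> b"
    if "a \<in> list_span vs" "b \<in> list_span vs" for a b
  proof -
    have ab: "a \<in> carrier G" "b \<in> carrier G" using that list_span_closed[OF vs] by auto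
    show "v \<otimes> a \<otimes> b = v \<otimes> (a \<otimes> b)" "a \<otimes> (v \<otimes> b) = v \<otimes> (a \<otimes> b)"
      using ab v by (simp_all add: m_ac)
    show "v \<otimes> a \<otimes> (v \<otimes> b) = a \<otimes> b"
      using ab v by (simp add: m_lcomm[of a v b] m_assoc cancel_twice)
  qed
  from Cons.prems(2,3) show ?case
    by (auto simp: mixed IH)
qed (auto simp: square_one)

lemma list_span_least:
  assumes "subgroup U G" "set vs \<subseteq> U"
  shows "list_span vs \<subseteq> U"
  using assms(2)
  by (induction vs) (auto intro: subgroup.one_closed[OF assms(1)] subgroup.m_closed[OF assms(1)])

lemma subgroup_list_span: "set vs \<subseteq> carrier G \<Longrightarrow> subgroup (list_span vs) G"
proof
  fix x assume vs: "set vs \<subseteq> carrier G" and x: "x \<in> list_span vs"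
  then have "x \<in> carrier G" using list_span_closed by blast
  then have "inv x = x" using square_one inv_equality by blast
  then show "inv x \<in> list_span vs" using x by simp
qed (use list_span_mult one_in_list_span list_span_closed in auto)

lemma list_span_Cons_disjoint:
  assumes "set vs \<subseteq> carrier G" "v \<in> carrier G" "v \<notin> list_span vs"
  shows "list_span vs \<inter> (\<lambda>x. v \<otimes> x) ` list_span vs = {}"
proof -
  have False if "x \<in> list_span vs" "v \<otimes> x \<in> list_span vs" for x
  proof -
    have "v \<otimes> x \<otimes> x = v"
      using that assms list_span_closed[of vs] by (auto simp: m_assoc square_one)
    then show False using list_span_mult[OF assms(1) that(2,1)] assms(3) by simp
  qed
  then show ?thesis by blast
qed

lemma card_list_span:
  "\<lbrakk>set vs \<subseteq> carrier G; indep vs\<rbrakk> \<Longrightarrow> card (list_span vs) = 2 ^ length vs"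
proof (induction vs)
  case (Cons v vs)
  have inj: "inj_on (\<lambda>x. v \<otimes> x) (list_span vs)"
    using Cons.prems list_span_closed[of vs] by (intro inj_onI) (auto simp: subset_iff)
  show ?case
    using Cons list_span_Cons_disjoint[of vs v]
    by (simp add: card_Un_disjoint finite_list_span card_image[OF inj])
qed simp

lemma list_span_append:
  assumes "set vs \<subseteq> carrier G" "set us \<subseteq> carrier G" "x \<in> list_span (vs @ us)"
  obtains a b where "a \<in> list_span vs" "b \<in> list_span us" "x = a \<otimes> b"
proof -
  have "\<exists>a\<in>list_span vs. \<exists>b\<in>list_span us. x = a \<otimes> b"
    using assms(1,3)
  proof (induction vs arbitrary: x)
    case Nil
    then show ?case using list_span_closed[OF assms(2)] by (auto simp: subset_iff)
  next
    case (Cons v vs)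
    then have v: "v \<in> carrier G" and vs: "set vs \<subseteq> carrier G" by auto
    from Cons.prems(2) consider "x \<in> list_span (vs @ us)"
      | y where "y \<in> list_span (vs @ us)" "x = v \<otimes> y" by auto
    then show ?case
    proof cases
      case 1
      then obtain a b where "a \<in> list_span vs" "b \<in> list_span us" "x = a \<otimes> b"
        using Cons.IH[OF vs] by blast
      then show ?thesis by auto
    next
      case 2
      then obtain a b where ab: "a \<in> list_span vs" "b \<in> list_span us" "y = a \<otimes> b"
        using Cons.IH[OF vs] by blast
      then have "x = v \<otimes> a \<otimes> b"
        using 2 v list_span_closed[OF vs] list_span_closed[OF assms(2)] by (simp add: m_assoc subsetD)
      then show ?thesis using ab by auto
    qed
  qed
  then show thesis using that by blast
qed

text \<open>
  New vectors are added at the front, so the given list \<open>us\<close> stays a suffix, and the vector chosen first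
  is the last entry.
\<close>

definition indep_extensions :: "'a set \<Rightarrow> 'a list \<Rightarrow> nat \<Rightarrow> 'a list set" where
  "indep_extensions U us l = {ws. length ws = l \<and> set ws \<subseteq> U \<and> indep (ws @ us)}"

lemma indep_extensions_Suc:
  "indep_extensions U us (Suc l) =
     (\<lambda>(ws, w). w # ws) ` (SIGMA ws:indep_extensions U us l. U - list_span (ws @ us))"
proof (intro equalityI subsetI)
  fix xs assume "xs \<in> indep_extensions U us (Suc l)"
  then show "xs \<in> (\<lambda>(ws, w). w # ws) ` (SIGMA ws:indep_extensions U us l. U - list_span (ws @ us))"
    by (cases xs) (auto simp: indep_extensions_def image_iff)
qed (auto simp: indep_extensions_def)

lemma finite_indep_extensions: "finite U \<Longrightarrow> finite (indep_extensions U us l)"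
  by (rule finite_subset[OF _ finite_lists_length_eq[of U l]]) (auto simp: indep_extensions_def)

text \<open>
  The next entry must avoid the span of the present list, which has \<open>2\<^sup>j\<close> elements if the list has length \<open>j\<close>.
  The formula also holds when \<open>U\<close> is too small for \<open>l\<close> more independent entries: as soon as the choices
  fill \<open>U\<close>, a factor vanishes.
\<close>

lemma card_indep_extensions:
  assumes "finite U" "subgroup U G" "set us \<subseteq> U" "indep us"
  shows "card (indep_extensions U us l) = (\<Prod>j = length us..<length us + l. card U - 2 ^ j)"
proof (induction l)
  case 0
  have "indep_extensions U us 0 = {[]}" using assms by (auto simp: indep_extensions_def)
  then show ?case by simp
next
  case (Suc l)
  have sub: "U \<subseteq> carrier G" using assms(2) by (rule subgroup.subset)
  have card_choices: "card (U - list_span (ws @ us)) = card U - 2 ^ (length us + l)"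
    if "ws \<in> indep_extensions U us l" for ws
  proof -
    have ws: "set (ws @ us) \<subseteq> U" "indep (ws @ us)" "length ws = l"
      using that assms by (auto simp: indep_extensions_def)
    have "card (list_span (ws @ us)) = 2 ^ (length us + l)"
      using card_list_span[of "ws @ us"] ws sub by (auto simp: add.commute)
    then show ?thesis
      using card_Diff_subset[OF finite_list_span list_span_least[OF assms(2) ws(1)]] by simp
  qed
  have "card (indep_extensions U us (Suc l)) =
      card (SIGMA ws:indep_extensions U us l. U - list_span (ws @ us))"
    unfolding indep_extensions_Suc by (rule card_image) (auto simp: inj_on_def)
  also have "\<dots> = (\<Sum>ws\<in>indep_extensions U us l. card (U - list_span (ws @ us)))"
    using assms(1) by (intro card_SigmaI) (auto simp: finite_indep_extensions)
  also have "\<dots> = card (indep_extensions U us l) * (card U - 2 ^ (length us + l))"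
    by (simp add: card_choices)
  finally show ?case by (simp add: Suc)
qed

lemma hom_image_list_span:
  assumes "N \<in> hom G G" "set vs \<subseteq> carrier G"
  shows "N ` list_span vs = list_span (map N vs)"
  using assms(2)
proof (induction vs)
  case Nil
  then show ?case using hom_one[OF assms(1)] is_group by simp
next
  case (Cons v vs)
  have "N (v \<otimes> x) = N v \<otimes> N x" if "x \<in> list_span vs" for x
    using that Cons.prems list_span_closed[of vs] hom_mult[OF assms(1)] by auto
  then have "N ` (\<lambda>x. v \<otimes> x) ` list_span vs = (\<lambda>x. N v \<otimes> x) ` N ` list_span vs"
    by (auto simp: image_image)
  then show ?case using Cons by (simp add: image_Un)
qed

lemma hom_eq_on_list_span:
  assumes "M \<in> hom G G" "N \<in> hom G G" "set vs \<subseteq> carrier G" "map M vs = map N vs"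
    and "x \<in> list_span vs"
  shows "M x = N x"
  using assms(3-5)
proof (induction vs arbitrary: x)
  case Nil
  then show ?case using hom_one[OF assms(1)] hom_one[OF assms(2)] is_group by simp
next
  case (Cons v vs)
  then show ?case
    using list_span_closed[of vs] hom_mult[OF assms(1)] hom_mult[OF assms(2)] by auto
qed

text \<open>
  If \<open>v y\<close> is in the kernel with \<open>y\<close> in the span of the entries after \<open>v\<close>, then \<open>N v = N y\<close>, which is a
  dependence among the images.
\<close>

lemma hom_kernel_list_span:
  assumes "N \<in> hom G G" "set vs \<subseteq> carrier G" "indep (map N vs)"
    and "x \<in> list_span vs" "N x = \<one>"
  shows "x = \<one>"
  using assms(2-5)
proof (induction vs arbitrary: x)
  case (Cons v vs)
  have vs: "set vs \<subseteq> carrier G" and v: "v \<in> carrier G" using Cons.prems by auto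
  show ?case
  proof (cases "x \<in> list_span vs")
    case True
    then show ?thesis using Cons by auto
  next
    case False
    then obtain y where y: "y \<in> list_span vs" "x = v \<otimes> y" using Cons.prems by auto
    have yc: "y \<in> carrier G" using y list_span_closed[OF vs] by auto
    have "N v \<otimes> N y = \<one>" using Cons.prems y yc v hom_mult[OF assms(1)] by auto
    then have "N v = N y"
      using mult_eq_one_iff hom_in_carrier[OF assms(1)] v yc by auto
    then have "N v \<in> list_span (map N vs)"
      using hom_image_list_span[OF assms(1) vs] y by auto
    then show ?thesis using Cons.prems by simp
  qed
qed simp

text \<open>
  A dependence among the images would put a product of entries of \<open>vs\<close> into the kernel, hence into
  the span of \<open>us\<close>.
\<close>

lemma indep_map_hom:
  assumes "N \<in> hom G G" "set vs \<subseteq> carrier G" "set us \<subseteq> carrier G" "indep (vs @ us)"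
    and "{x \<in> carrier G. N x = \<one>} \<subseteq> list_span us"
  shows "indep (map N vs)"
  using assms(2,4)
proof (induction vs)
  case (Cons v vs)
  have vs: "set vs \<subseteq> carrier G" and v: "v \<in> carrier G" using Cons.prems by auto
  have "N v \<notin> list_span (map N vs)"
  proof
    assume "N v \<in> list_span (map N vs)"
    then obtain y where y: "y \<in> list_span vs" "N v = N y"
      using hom_image_list_span[OF assms(1) vs] by auto
    have yc: "y \<in> carrier G" using y list_span_closed[OF vs] by auto
    have "N (y \<otimes> v) = \<one>"
      using y yc v hom_mult[OF assms(1)] hom_in_carrier[OF assms(1)] square_one by metis
    then have mem: "y \<otimes> v \<in> list_span us" using assms(5) v yc by auto
    have sub: "list_span vs \<subseteq> list_span (vs @ us)" "list_span us \<subseteq> list_span (vs @ us)"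
      by (rule list_span_least; use vs assms(3) set_subset_list_span[of "vs @ us"] in
          \<open>auto intro!: subgroup_list_span\<close>)+
    have "y \<otimes> (y \<otimes> v) \<in> list_span (vs @ us)"
    proof (rule list_span_mult)
      show "set (vs @ us) \<subseteq> carrier G" using vs assms(3) by simp
    qed (use sub mem y in auto)
    then show False using Cons.prems cancel_twice[OF yc v] by simp
  qed
  then show ?case using Cons by simp
qed simp

text \<open>
  By induction on the list: an element of the new coset \<open>v \<cdot> span vs\<close> is moved back into \<open>span vs\<close> by
  multiplication with \<open>v\<close>, which is its own inverse.
\<close>

lemma hom_extension_exists:
  assumes "set vs \<subseteq> carrier G" "indep vs" "length ws = length vs" "set ws \<subseteq> carrier G"
  shows "\<exists>F. F ` list_span vs \<subseteq> carrier G \<and> map F vs = ws \<and>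
    (\<forall>x\<in>list_span vs. \<forall>y\<in>list_span vs. F (x \<otimes> y) = F x \<otimes> F y)"
  using assms(3,1,2,4)
proof (induction ws vs rule: list_induct2)
  case Nil
  show ?case by (rule exI[of _ "\<lambda>x. \<one>"]) auto
next
  case (Cons w ws v vs)
  have vs: "set vs \<subseteq> carrier G" and v: "v \<in> carrier G" and w: "w \<in> carrier G"
    and nv: "v \<notin> list_span vs" using Cons.prems by auto
  from Cons obtain F where F: "F ` list_span vs \<subseteq> carrier G" "map F vs = ws"
    and mult: "\<And>x y. x \<in> list_span vs \<Longrightarrow> y \<in> list_span vs \<Longrightarrow> F (x \<otimes> y) = F x \<otimes> F y"
    by auto
  define E where "E = (\<lambda>x. if x \<in> list_span vs then F x else w \<otimes> F (v \<otimes> x))"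
  have E0: "E x = F x" if "x \<in> list_span vs" for x
    using that by (simp add: E_def)
  have car: "x \<in> carrier G" if "x \<in> list_span vs" for x
    using that list_span_closed[OF vs] by auto
  have Fcar: "F x \<in> carrier G" if "x \<in> list_span vs" for x
    using that F by auto
  have E1: "E (v \<otimes> x) = w \<otimes> F x" if "x \<in> list_span vs" for x
    using list_span_Cons_disjoint[OF vs v nv] that v car by (auto simp: E_def cancel_twice)
  have Ecar: "E x \<in> carrier G" if "x \<in> list_span (v # vs)" for x
    using that w Fcar by (auto simp: E0 E1)
  have Emult: "E (x \<otimes> y) = E x \<otimes> E y"
    if "x \<in> list_span (v # vs)" "y \<in> list_span (v # vs)" for x y
  proof -
    have reassoc: "v \<otimes> a \<otimes> b = v \<otimes> (a \<otimes> b)" "a \<otimes> (v \<otimes> b) = v \<otimes> (a \<otimes> b)"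
      "v \<otimes> a \<otimes> (v \<otimes> b) = a \<otimes> b"
      "w \<otimes> F a \<otimes> F b = w \<otimes> (F a \<otimes> F b)" "F a \<otimes> (w \<otimes> F b) = w \<otimes> (F a \<otimes> F b)"
      "w \<otimes> F a \<otimes> (w \<otimes> F b) = F a \<otimes> F b"
      if "a \<in> list_span vs" "b \<in> list_span vs" for a b
      using v w car[OF that(1)] car[OF that(2)] Fcar[OF that(1)] Fcar[OF that(2)]
      by (simp_all add: m_assoc m_lcomm[of a v b] m_lcomm[of "F a" w "F b"] cancel_twice)
    from that show ?thesis
      using list_span_mult[OF vs] by (auto simp: E0 E1 reassoc mult)
  qed
  have "F \<one> = \<one>"
    using mult[OF one_in_list_span one_in_list_span] Fcar[OF one_in_list_span]
    by (metis l_one one_closed square_one)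
  then have "E v = w"
    using E1[OF one_in_list_span] v w by simp
  moreover have "map E vs = ws"
    using F(2) E0 set_subset_list_span[OF vs] by (auto intro: map_cong)
  ultimately show ?case
    using Ecar Emult by (intro exI[of _ E]) auto
qed

section \<open>Counting involutive automorphisms by their fixed points\<close>

definition fixing_involutions :: "'a \<Rightarrow> ('a \<Rightarrow> 'a) set" where
  "fixing_involutions z =
     {g \<in> extensional (carrier G) \<inter> hom G G. g z = z \<and> (\<forall>x\<in>carrier G. g (g x) = x)}"

abbreviation fixed_points :: "('a \<Rightarrow> 'a) \<Rightarrow> 'a set" where
  "fixed_points g \<equiv> {x \<in> carrier G. g x = x}"

lemma displacement_hom:
  assumes "g \<in> hom G G"
  shows "(\<lambda>x. x \<otimes> g x) \<in> hom G G"
  using assms by (auto simp: hom_def Pi_iff m_ac)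

lemma subgroup_fixed_points:
  assumes "g \<in> hom G G"
  shows "subgroup (fixed_points g) G"
proof
  fix x assume x: "x \<in> fixed_points g"
  then have "inv x = x" using square_one inv_equality by blast
  then show "inv x \<in> fixed_points g" using x by simp
qed (use assms hom_one[OF assms] hom_mult[OF assms] is_group in auto)

text \<open>
  The displacements \<open>x g(x)\<close> are fixed by \<open>g\<close>, and the displacement map has the span of \<open>us\<close> as its
  kernel.
\<close>

lemma involution_displacements_independent:
  assumes g: "g \<in> hom G G" "\<And>x. x \<in> carrier G \<Longrightarrow> g (g x) = x"
    and fixed: "fixed_points g = list_span us"
    and carrier: "set vs \<subseteq> carrier G" "set us \<subseteq> carrier G" and indep: "indep (vs @ us)"
  shows "map (\<lambda>x. x \<otimes> g x) vs \<in> indep_extensions (list_span us) [] (length vs)"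
proof -
  have gc: "g x \<in> carrier G" if "x \<in> carrier G" for x
    using hom_in_carrier[OF g(1) that] .
  have "indep (map (\<lambda>x. x \<otimes> g x) vs)"
  proof (rule indep_map_hom[OF displacement_hom[OF g(1)] carrier indep])
    show "{x \<in> carrier G. x \<otimes> g x = \<one>} \<subseteq> list_span us"
      unfolding fixed[symmetric] using mult_eq_one_iff gc by auto
  qed
  moreover have "g (x \<otimes> g x) = x \<otimes> g x" if "x \<in> carrier G" for x
    using that g(2) gc hom_mult[OF g(1)] by (simp add: m_comm)
  ultimately show ?thesis
    using carrier gc unfolding fixed[symmetric] by (auto simp: indep_extensions_def)
qed

text \<open>
  Let \<open>D\<close> be the homomorphism that sends the entries of \<open>vs\<close> to those of \<open>ws\<close> and kills \<open>us\<close>. Its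
  range lies in the span of \<open>us\<close>, hence in its kernel, which makes \<open>x \<mapsto> x D(x)\<close> an involution; and
  its kernel is no larger than the span of \<open>us\<close>, because \<open>ws\<close> is independent.
\<close>

lemma involution_with_displacements:
  assumes vs: "set vs \<subseteq> carrier G" and us: "set us \<subseteq> carrier G"
    and indep: "indep (vs @ us)" and span: "list_span (vs @ us) = carrier G"
    and ws: "ws \<in> indep_extensions (list_span us) [] (length vs)"
  obtains g where "g \<in> extensional (carrier G)" "g \<in> hom G G"
    "\<forall>x\<in>carrier G. g (g x) = x"
    "fixed_points g = list_span us" "map (\<lambda>x. x \<otimes> g x) vs = ws"
proof -
  have ws: "set ws \<subseteq> list_span us" "indep ws" "length ws = length vs"
    using ws by (auto simp: indep_extensions_def)
  have wsc: "set ws \<subseteq> carrier G" using ws(1) list_span_closed[OF us] by blast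
  obtain D where D: "D ` carrier G \<subseteq> carrier G" "map D (vs @ us) = ws @ map (\<lambda>_. \<one>) us"
    and D_mult: "\<And>x y. \<lbrakk>x \<in> carrier G; y \<in> carrier G\<rbrakk> \<Longrightarrow> D (x \<otimes> y) = D x \<otimes> D y"
  proof -
    have "set (ws @ map (\<lambda>_. \<one>) us) \<subseteq> carrier G" using wsc by auto
    then show thesis
      using hom_extension_exists[OF _ indep, of "ws @ map (\<lambda>_. \<one>) us"] vs us ws(3) that
      unfolding span by auto
  qed
  have D_hom: "D \<in> hom G G" using D(1) D_mult by (auto simp: hom_def)
  have D_vs: "map D vs = ws" and D_us: "map D us = map (\<lambda>_. \<one>) us"
    using D(2) ws(3) by (auto simp: append_eq_append_conv)
  have one_hom: "(\<lambda>_. \<one>) \<in> hom G G" by (auto simp: hom_def)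
  have D_kill: "D x = \<one>" if "x \<in> list_span us" for x
    using hom_eq_on_list_span[OF D_hom one_hom us D_us that] .
  have span_ws: "list_span ws \<subseteq> list_span us"
    by (rule list_span_least[OF subgroup_list_span[OF us] ws(1)])
  have Dc: "D x \<in> carrier G" if "x \<in> carrier G" for x using D(1) that by auto
  have decompose: "\<exists>a\<in>list_span vs. \<exists>b\<in>list_span us. x = a \<otimes> b \<and> D x = D a"
    if "x \<in> carrier G" for x
  proof -
    from that have "x \<in> list_span (vs @ us)" unfolding span .
    then obtain a b where ab: "a \<in> list_span vs" "b \<in> list_span us" "x = a \<otimes> b"
      using list_span_append[OF vs us] by blast
    have "a \<in> carrier G" "b \<in> carrier G"
      using ab list_span_closed[OF vs] list_span_closed[OF us] by auto
    then have "D x = D a" using ab D_mult D_kill Dc by simp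
    then show ?thesis using ab by blast
  qed
  have D_range: "D x \<in> list_span us" if "x \<in> carrier G" for x
    using decompose[OF that] hom_image_list_span[OF D_hom vs] D_vs span_ws by auto
  have D_kernel: "D x = \<one> \<longleftrightarrow> x \<in> list_span us" if x: "x \<in> carrier G" for x
  proof
    assume "D x = \<one>"
    then obtain a b where ab: "a \<in> list_span vs" "b \<in> list_span us" "x = a \<otimes> b" "D a = \<one>"
      using decompose[OF x] by auto
    then have "a = \<one>"
      using hom_kernel_list_span[OF D_hom vs] ws(2) D_vs by simp
    then show "x \<in> list_span us" using ab list_span_closed[OF us] by auto
  qed (rule D_kill)
  define g where "g = restrict (\<lambda>x. x \<otimes> D x) (carrier G)"
  have g_hom: "g \<in> hom G G"
    using displacement_hom[OF D_hom] by (auto simp: g_def hom_def Pi_iff)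
  \<comment> \<open>the fixed points of \<open>g\<close> are the kernel of \<open>D\<close>\<close>
  have g_fix: "fixed_points g = list_span us"
  proof -
    have "x \<otimes> D x = x \<longleftrightarrow> D x = \<one>" if "x \<in> carrier G" for x
      using that Dc by (metis l_cancel_one')
    then show ?thesis using D_kernel list_span_closed[OF us] by (auto simp: g_def)
  qed
  have g_g: "\<forall>x\<in>carrier G. g (g x) = x"
  proof
    fix x assume x: "x \<in> carrier G"
    have "D (x \<otimes> D x) = D x" using D_mult D_kill[OF D_range[OF x]] Dc x by simp
    then show "g (g x) = x" using x Dc by (simp add: g_def m_assoc square_one)
  qed
  have g_vs: "map (\<lambda>x. x \<otimes> g x) vs = ws"
    unfolding D_vs[symmetric] using vs Dc by (auto simp: g_def cancel_twice)
  show thesis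
    by (rule that[OF _ g_hom g_g g_fix g_vs]) (simp_all only: g_def restrict_extensional)
qed

text \<open>
  This is a double count. Let \<open>B\<close> be the number of ways to complete \<open>k\<close> independent vectors to a basis
  of \<open>G\<close>. The fixed points of each \<open>g\<close> have as many bases that start with \<open>z\<close> as the product on
  the left says, so \<open>B\<close> times the left-hand side counts the pairs of \<open>g\<close> and an adapted basis. The
  factors on the right count the ways to extend \<open>z\<close> to \<open>k\<close> independent vectors of \<open>G\<close> and the choices
  of independent displacements in their span; \<open>B\<close> times their product counts the same pairs. The
  subtractions are on natural numbers: if \<open>2k < n\<close>, the last product contains the factor for \<open>j = k\<close>,
  which is zero, so there are no such \<open>g\<close>.
\<close>

lemma card_involutions_by_fixed_points:
  assumes card_G: "card (carrier G) = 2 ^ n" and z: "z \<in> carrier G" "z \<noteq> \<one>"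
    and k: "1 \<le> k" "k \<le> n"
  shows "card {g \<in> fixing_involutions z. card (fixed_points g) = 2 ^ k} * (\<Prod>j = 1..<k. 2 ^ k - 2 ^ j) =
    (\<Prod>j = 1..<k. 2 ^ n - 2 ^ j) * (\<Prod>j = 0..<n - k. 2 ^ k - 2 ^ j)"
proof -
  define A where "A = {g \<in> fixing_involutions z. card (fixed_points g) = 2 ^ k}"
  let ?B = "\<Prod>j = k..<n. 2 ^ n - 2 ^ j :: nat"
  let ?E = "indep_extensions"
  have fin: "finite (carrier G)" using card_G by (intro card_ge_0_finite) simp
  have indep_z: "indep [z]" using z by simp
  have finA: "finite A"
  proof (rule finite_subset[OF _ finite_PiE[OF fin, of "\<lambda>_. carrier G"]])
    show "A \<subseteq> carrier G \<rightarrow>\<^sub>E carrier G"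
      by (auto simp: A_def fixing_involutions_def hom_def PiE_def)
  qed (rule fin)
  \<comment> \<open>involutions with an adapted basis: \<open>us @ [z]\<close> spans the fixed points, \<open>vs\<close> completes it\<close>
  define P where "P = (SIGMA g:A. SIGMA us:?E (fixed_points g) [z] (k - 1).
      ?E (carrier G) (us @ [z]) (n - k))"
  \<comment> \<open>bases beginning with \<open>z\<close>, with independent displacements for the entries of \<open>vs\<close>\<close>
  define Q where "Q = (SIGMA us:?E (carrier G) [z] (k - 1). ?E (carrier G) (us @ [z]) (n - k) \<times>
      ?E (list_span (us @ [z])) [] (n - k))"
  have us: "set (us @ [z]) \<subseteq> carrier G" "indep (us @ [z])" "length (us @ [z]) = k"
    if "us \<in> ?E U [z] (k - 1)" "U \<subseteq> carrier G" for us U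
    using that z k by (auto simp: indep_extensions_def)
  have card_completions: "card (?E (carrier G) (us @ [z]) (n - k)) = ?B"
    if "us \<in> ?E U [z] (k - 1)" "U \<subseteq> carrier G" for us U
    using card_indep_extensions[OF fin subgroup_self us(1,2)[OF that], of "n - k"] card_G k
    by (simp only: us(3)[OF that] le_add_diff_inverse)
  have card_P: "card P = card A * ((\<Prod>j = 1..<k. 2 ^ k - 2 ^ j) * ?B)"
  proof -
    have "card (SIGMA us:?E (fixed_points g) [z] (k - 1). ?E (carrier G) (us @ [z]) (n - k)) =
        (\<Prod>j = 1..<k. 2 ^ k - 2 ^ j) * ?B" if "g \<in> A" for g
    proof -
      have g: "g \<in> hom G G" "g z = z" "card (fixed_points g) = 2 ^ k"
        using that by (auto simp: A_def fixing_involutions_def)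
      have "card (?E (fixed_points g) [z] (k - 1)) = (\<Prod>j = 1..<k. 2 ^ k - 2 ^ j)"
        using card_indep_extensions[OF _ subgroup_fixed_points[OF g(1)] _ indep_z, of "k - 1"] g z k fin
        by simp
      moreover have "card (?E (carrier G) (us @ [z]) (n - k)) = ?B"
        if "us \<in> ?E (fixed_points g) [z] (k - 1)" for us
        using card_completions[OF that] by auto
      ultimately show ?thesis
        using fin by (subst card_SigmaI) (auto simp: finite_indep_extensions)
    qed
    then show ?thesis
      unfolding P_def using fin finA
      by (subst card_SigmaI) (auto simp: finite_indep_extensions intro!: finite_SigmaI)
  qed
  have card_Q: "card Q = (\<Prod>j = 1..<k. 2 ^ n - 2 ^ j) * (?B * (\<Prod>j = 0..<n - k. 2 ^ k - 2 ^ j))"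
  proof -
    have "card (?E (list_span (us @ [z])) [] (n - k)) = (\<Prod>j = 0..<n - k. 2 ^ k - 2 ^ j)"
      if "us \<in> ?E (carrier G) [z] (k - 1)" for us
      using card_indep_extensions[OF finite_list_span subgroup_list_span[OF us(1)[OF that]], of "[]" "n - k"]
        card_list_span[OF us(1,2)[OF that]]
      by (simp only: us(3)[OF that]) simp
    moreover have "card (?E (carrier G) [z] (k - 1)) = (\<Prod>j = 1..<k. 2 ^ n - 2 ^ j)"
      using card_indep_extensions[OF fin subgroup_self _ indep_z, of "k - 1"] z k card_G by simp
    ultimately show ?thesis
      unfolding Q_def using fin
      by (subst card_SigmaI)
        (auto simp: finite_indep_extensions finite_list_span card_cartesian_product card_completions)
  qed
  define \<Phi> where "\<Phi> = (\<lambda>(g, us :: 'a list, vs). (us, vs, map (\<lambda>x. x \<otimes> g x) vs))"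
  have spans: "list_span (vs @ us @ [z]) = carrier G"
    if "us \<in> ?E U [z] (k - 1)" "U \<subseteq> carrier G" "vs \<in> ?E (carrier G) (us @ [z]) (n - k)" for U us vs
  proof (rule card_subset_eq[OF fin])
    have vs: "set (vs @ us @ [z]) \<subseteq> carrier G" "indep (vs @ us @ [z])" "length (vs @ us @ [z]) = n"
      using us[OF that(1,2)] that(3) k by (auto simp: indep_extensions_def)
    show "list_span (vs @ us @ [z]) \<subseteq> carrier G" using list_span_closed[OF vs(1)] .
    show "card (list_span (vs @ us @ [z])) = card (carrier G)"
      using card_list_span[OF vs(1,2)] by (simp only: vs(3) card_G)
  qed
  have "bij_betw \<Phi> P Q"
  proof (rule bij_betw_imageI)
    show "inj_on \<Phi> P"
    proof (rule inj_onI)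
      fix p q assume pq: "p \<in> P" "q \<in> P" "\<Phi> p = \<Phi> q"
      obtain g us vs h where p: "p = (g, us, vs)" and q: "q = (h, us, vs)"
        and eq: "map (\<lambda>x. x \<otimes> g x) vs = map (\<lambda>x. x \<otimes> h x) vs"
        using pq(3) by (cases p; cases q) (auto simp: \<Phi>_def)
      have mem: "us \<in> ?E (fixed_points g) [z] (k - 1)" "vs \<in> ?E (carrier G) (us @ [z]) (n - k)"
        "us \<in> ?E (fixed_points h) [z] (k - 1)"
        using pq(1,2) by (auto simp: P_def p q)
      have gh: "g \<in> hom G G" "h \<in> hom G G" "g z = z" "h z = z"
        "g \<in> extensional (carrier G)" "h \<in> extensional (carrier G)"
        using pq(1,2) by (auto simp: P_def p q A_def fixing_involutions_def)
      have vs: "set vs \<subseteq> carrier G" using mem by (auto simp: indep_extensions_def)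
      have "map g vs = map h vs"
        using eq vs hom_in_carrier[OF gh(1)] hom_in_carrier[OF gh(2)] by (auto simp: subset_iff)
      then have "map g (vs @ us @ [z]) = map h (vs @ us @ [z])"
        using mem gh by (auto simp: indep_extensions_def subset_iff)
      then have "g x = h x" if "x \<in> carrier G" for x
        using hom_eq_on_list_span[OF gh(1,2), of "vs @ us @ [z]" x] that vs mem z
          spans[OF mem(1) _ mem(2)] us(1)[OF mem(1)] by auto
      then have "g = h" using gh by (intro extensionalityI) auto
      then show "p = q" by (simp add: p q)
    qed
    show "\<Phi> ` P = Q"
    proof (intro equalityI subsetI)
      fix q assume "q \<in> \<Phi> ` P"
      then obtain g us vs where q: "q = (us, vs, map (\<lambda>x. x \<otimes> g x) vs)" and gA: "g \<in> A"
        and mem: "us \<in> ?E (fixed_points g) [z] (k - 1)" "vs \<in> ?E (carrier G) (us @ [z]) (n - k)"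
        by (auto simp: P_def \<Phi>_def)
      have g: "g \<in> hom G G" "g z = z" "card (fixed_points g) = 2 ^ k"
        "\<And>x. x \<in> carrier G \<Longrightarrow> g (g x) = x"
        using gA by (auto simp: A_def fixing_involutions_def)
      have usz: "set (us @ [z]) \<subseteq> carrier G" "indep (us @ [z])" "length (us @ [z]) = k"
        using us[OF mem(1)] by auto
      have fix_eq: "list_span (us @ [z]) = fixed_points g"
      proof (rule card_subset_eq)
        show "list_span (us @ [z]) \<subseteq> fixed_points g"
          using mem(1) z g(2)
          by (intro list_span_least subgroup_fixed_points g(1)) (auto simp: indep_extensions_def)
        show "card (list_span (us @ [z])) = card (fixed_points g)"
          using card_list_span[OF usz(1,2)] by (simp only: usz(3) g(3))
      qed (use fin in auto)
      have vs: "set vs \<subseteq> carrier G" "indep (vs @ us @ [z])" "length vs = n - k"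
        using mem(2) by (auto simp: indep_extensions_def)
      have "map (\<lambda>x. x \<otimes> g x) vs \<in> ?E (list_span (us @ [z])) [] (n - k)"
        using involution_displacements_independent[OF g(1,4) fix_eq[symmetric] vs(1) usz(1) vs(2)]
        unfolding vs(3) .
      then show "q \<in> Q"
        using mem by (auto simp: Q_def q indep_extensions_def)
    next
      fix q assume "q \<in> Q"
      then obtain us vs ws where q: "q = (us, vs, ws)"
        and mem: "us \<in> ?E (carrier G) [z] (k - 1)" "vs \<in> ?E (carrier G) (us @ [z]) (n - k)"
          "ws \<in> ?E (list_span (us @ [z])) [] (n - k)"
        by (auto simp: Q_def)
      have usz: "set (us @ [z]) \<subseteq> carrier G" "indep (us @ [z])" "length (us @ [z]) = k"
        using us[OF mem(1)] by auto
      have vs: "set vs \<subseteq> carrier G" "indep (vs @ us @ [z])" "length vs = n - k"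
        using mem(2) by (auto simp: indep_extensions_def)
      have span: "list_span (vs @ us @ [z]) = carrier G" using spans[OF mem(1) _ mem(2)] by simp
      have ws: "ws \<in> ?E (list_span (us @ [z])) [] (length vs)" using mem(3) vs(3) by simp
      obtain g where g: "g \<in> extensional (carrier G)" "g \<in> hom G G"
          "\<forall>x\<in>carrier G. g (g x) = x"
        and g_fix: "fixed_points g = list_span (us @ [z])" and g_vs: "map (\<lambda>x. x \<otimes> g x) vs = ws"
        by (rule involution_with_displacements[OF vs(1) usz(1) vs(2) span ws])
      have "z \<in> fixed_points g"
        unfolding g_fix using set_subset_list_span[OF usz(1)] by simp
      moreover have "card (fixed_points g) = 2 ^ k"
        unfolding g_fix using card_list_span[OF usz(1,2)] by (simp only: usz(3))
      ultimately have "g \<in> A"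
        using g by (auto simp: A_def fixing_involutions_def)
      moreover have "us \<in> ?E (fixed_points g) [z] (k - 1)"
        unfolding g_fix using mem(1) set_subset_list_span[OF usz(1)] by (auto simp: indep_extensions_def)
      ultimately show "q \<in> \<Phi> ` P"
        using mem(2) g_vs by (auto simp: P_def q \<Phi>_def image_iff)
    qed
  qed
  then have "card P = card Q" by (rule bij_betw_same_card)
  moreover have "?B \<noteq> 0" using k by (auto simp: prod_zero_iff)
  ultimately have "card A * (\<Prod>j = 1..<k. 2 ^ k - 2 ^ j) =
      (\<Prod>j = 1..<k. 2 ^ n - 2 ^ j) * (\<Prod>j = 0..<n - k. 2 ^ k - 2 ^ j)"
    unfolding card_P card_Q by (simp add: mult.assoc mult.left_commute[of _ ?B] mult.commute[of _ ?B])
  then show ?thesis unfolding A_def .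
qed

text \<open>
  The number of fixed points divides \<open>2\<^sup>n\<close> and exceeds \<open>1\<close> because \<open>z\<close> is fixed, so it is \<open>2\<^sup>k\<close> with
  \<open>1 \<le> k \<le> n\<close>.
\<close>

lemma sum_card_fixed_points:
  assumes card_G: "card (carrier G) = 2 ^ n" and z: "z \<in> carrier G" "z \<noteq> \<one>"
  shows "real (\<Sum>g\<in>fixing_involutions z. card (fixed_points g)) =
    (\<Sum>k = nat \<lceil>real n / 2\<rceil>..n.
      (\<Prod>j = 1..<k. (2 ^ n - 2 ^ j) / (2 ^ k - 2 ^ j)) *
      (\<Prod>j = 0..<n - k. 2 ^ k - 2 ^ j) * 2 ^ k)"
proof -
  let ?I = "fixing_involutions z"
  let ?A = "\<lambda>k. {g \<in> ?I. card (fixed_points g) = 2 ^ k}"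
  let ?c = "\<lambda>k. (\<Prod>j = 1..<k. (2 ^ n - 2 ^ j) / (2 ^ k - 2 ^ j :: real)) *
      (\<Prod>j = 0..<n - k. 2 ^ k - 2 ^ j)"
  have fin: "finite (carrier G)" using card_G by (intro card_ge_0_finite) simp
  have finI: "finite ?I"
  proof (rule finite_subset[OF _ finite_PiE[OF fin, of "\<lambda>_. carrier G"]])
    show "?I \<subseteq> carrier G \<rightarrow>\<^sub>E carrier G"
      by (auto simp: fixing_involutions_def hom_def PiE_def)
  qed (rule fin)
  have card_A: "real (card (?A k)) = ?c k" if k: "k \<in> {1..n}" and big: "n \<le> 2 * k" for k
  proof -
    have le: "(2::nat) ^ j \<le> 2 ^ m" if "j \<le> m" for j m :: nat
      using that by (simp add: power_increasing)
    have r: "real (2 ^ m - 2 ^ j) = 2 ^ m - 2 ^ j" if "j \<le> m" for j m :: nat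
      using of_nat_diff[OF le[OF that]] by simp
    have "real (card (?A k)) * (\<Prod>j = 1..<k. 2 ^ k - 2 ^ j) =
        real (card (?A k) * (\<Prod>j = 1..<k. 2 ^ k - 2 ^ j))"
      by (simp add: r)
    also have "\<dots> = real ((\<Prod>j = 1..<k. 2 ^ n - 2 ^ j) * (\<Prod>j = 0..<n - k. 2 ^ k - 2 ^ j))"
      using card_involutions_by_fixed_points[OF card_G z, of k] k by (simp only: atLeastAtMost_iff)
    also have "\<dots> = (\<Prod>j = 1..<k. 2 ^ n - 2 ^ j) * (\<Prod>j = 0..<n - k. 2 ^ k - 2 ^ j)"
      using k big by (simp add: r)
    finally have "real (card (?A k)) * (\<Prod>j = 1..<k. 2 ^ k - 2 ^ j) =
        (\<Prod>j = 1..<k. 2 ^ n - 2 ^ j) * (\<Prod>j = 0..<n - k. 2 ^ k - 2 ^ j)" .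
    moreover have nonzero: "(\<Prod>j = 1..<k. 2 ^ k - 2 ^ j :: real) \<noteq> 0"
      by (auto simp: prod_zero_iff)
    ultimately have "real (card (?A k)) = (\<Prod>j = 1..<k. 2 ^ n - 2 ^ j) * (\<Prod>j = 0..<n - k. 2 ^ k - 2 ^ j) /
        (\<Prod>j = 1..<k. 2 ^ k - 2 ^ j)"
      unfolding nonzero_eq_divide_eq[OF nonzero] by blast
    then show ?thesis by (simp only: prod_dividef times_divide_eq_left)
  qed
  have small: "card (?A k) = 0" if k: "k \<in> {1..n}" and "2 * k < n" for k
  proof -
    have "(\<Prod>j = 0..<n - k. 2 ^ k - 2 ^ j :: nat) = 0" using that by (auto simp: prod_zero_iff)
    moreover have "(\<Prod>j = 1..<k. 2 ^ k - 2 ^ j :: nat) \<noteq> 0" by (auto simp: prod_zero_iff)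
    ultimately show ?thesis
      using card_involutions_by_fixed_points[OF card_G z, of k] k
      by (simp only: atLeastAtMost_iff mult_0_right mult_eq_0_iff) simp
  qed
  have power: "\<exists>k\<in>{1..n}. card (fixed_points g) = 2 ^ k" if "g \<in> ?I" for g
  proof -
    have g: "g \<in> hom G G" "g z = z" using that by (auto simp: fixing_involutions_def)
    have "card (fixed_points g) dvd Coset.order G"
      using lagrange[OF subgroup_fixed_points[OF g(1)], symmetric] by simp
    then have "card (fixed_points g) dvd 2 ^ n"
      by (simp only: Coset.order_def card_G)
    then obtain k where k: "k \<le> n" "card (fixed_points g) = 2 ^ k"
      using divides_primepow_nat[OF two_is_prime_nat] by blast
    have "{\<one>, z} \<subseteq> fixed_points g" using z g hom_one[OF g(1)] is_group by auto
    then have "card {\<one>, z} \<le> card (fixed_points g)" using fin by (intro card_mono) auto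
    then have "2 \<le> (2::nat) ^ k" using k z by simp
    then have "k \<noteq> 0" by (intro notI) simp
    then show ?thesis using k by auto
  qed
  have "(\<Sum>g\<in>?I. card (fixed_points g)) = (\<Sum>g\<in>(\<Union>k\<in>{1..n}. ?A k). card (fixed_points g))"
    using power by (intro sum.cong) auto
  also have "\<dots> = (\<Sum>k\<in>{1..n}. \<Sum>g\<in>?A k. card (fixed_points g))"
    using finI by (intro sum.UNION_disjoint) auto
  also have "\<dots> = (\<Sum>k\<in>{1..n}. card (?A k) * 2 ^ k)"
    by simp
  also have "real \<dots> = (\<Sum>k\<in>{1..n}. real (card (?A k)) * 2 ^ k)" by simp
  also have "\<dots> = (\<Sum>k = nat \<lceil>real n / 2\<rceil>..n. ?c k * 2 ^ k)"
  proof (rule sum.mono_neutral_cong_right)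
    have half: "nat \<lceil>real n / 2\<rceil> \<le> k \<longleftrightarrow> n \<le> 2 * k" for k
      by (simp add: nat_le_iff ceiling_le_iff) linarith
    have n: "n \<noteq> 0"
    proof
      assume "n = 0"
      then obtain a where "carrier G = {a}" using card_G by (auto simp: card_1_singleton_iff)
      then show False using z one_closed by auto
    qed
    show "{nat \<lceil>real n / 2\<rceil>..n} \<subseteq> {1..n}" using half n by (auto simp: Suc_le_eq intro!: Suc_leI) 
    show "\<forall>k\<in>{1..n} - {nat \<lceil>real n / 2\<rceil>..n}. real (card (?A k)) * 2 ^ k = 0"
    proof
      fix k assume "k \<in> {1..n} - {nat \<lceil>real n / 2\<rceil>..n}"
      then have "k \<in> {1..n}" "2 * k < n" using half[of k] by auto
      then show "real (card (?A k)) * 2 ^ k = 0" using small[of k] by simp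
    qed
    show "real (card (?A k)) * 2 ^ k = ?c k * 2 ^ k" if "k \<in> {nat \<lceil>real n / 2\<rceil>..n}" for k
    proof -
      have "k \<in> {1..n}" "n \<le> 2 * k" using that half n by auto
      then show ?thesis using card_A by simp
    qed
  qed simp
  finally show ?thesis .
qed

end

section \<open>The signed monomials\<close>

lemma MC_simps:
  "carrier (MC n) = mc_carrier n" "monoid.mult (MC n) = mc_times" "one (MC n) = mc_of_real n 1"
  "zero (MC n) = mc_of_real n 0" "add (MC n) = mc_plus" "module.smult (MC n) = mc_scale"
  by (simp_all add: MC_def)

lemma mc_minus: "x \<in> mc_carrier n \<Longrightarrow> \<ominus>\<^bsub>MC n\<^esub> x = mc_scale (- 1) x"
proof -
  interpret cring "MC n" by (rule MC_cring)
  show "x \<in> mc_carrier n \<Longrightarrow> \<ominus>\<^bsub>MC n\<^esub> x = mc_scale (- 1) x"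
    by (rule minus_equality) (auto simp: MC_simps mc_plus_minus mc_scale_closed)
qed

lemma mc_plus_zero_right: "a \<in> mc_carrier n \<Longrightarrow> mc_plus a (mc_of_real n 0) = a"
  by (metis mc_of_real_closed mc_plus_commute mc_plus_zero)

lemma mc_times_zero_right: "a \<in> mc_carrier n \<Longrightarrow> mc_times a (mc_of_real n 0) = mc_of_real n 0"
  by (metis mc_of_real_closed mc_times_commute mc_times_zero)

lemma mc_times_one_right: "a \<in> mc_carrier n \<Longrightarrow> mc_times a (mc_of_real n 1) = a"
  by (metis mc_of_real_closed mc_times_commute mc_times_one)

lemmas mc_zero_one_simps = mc_plus_zero mc_plus_zero_right mc_times_zero mc_times_zero_right
  mc_times_one mc_times_one_right mc_scale_zero mc_of_real_closed

lemma MC_Suc_embedding: "ring_hom_cring (MC n) (MC (Suc n)) (\<lambda>u. Adj u (mc_of_real n 0))"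
  by (intro ring_hom_cring.intro ring_hom_cring_axioms.intro ring_hom_memI MC_cring)
    (auto simp: MC_simps mc_zero_one_simps mc_times_closed)

abbreviation mc_monomial :: "nat \<Rightarrow> (nat \<Rightarrow> nat) \<Rightarrow> mc" where
  "mc_monomial n a \<equiv> (\<Otimes>\<^bsub>MC n\<^esub>k\<in>{1..n}. mc_unit n k [^]\<^bsub>MC n\<^esub> a k)"

lemma mc_monomial_closed: "mc_monomial n a \<in> mc_carrier n"
proof -
  interpret cring "MC n" by (rule MC_cring)
  have "mc_monomial n a \<in> carrier (MC n)"
    by (rule finprod_closed) (auto intro!: nat_pow_closed mc_unit_closed)
  then show ?thesis by (simp add: MC_simps)
qed

text \<open>
  The adjunction of \<open>i\<^sub>n\<^sub>+\<^sub>1\<close> turns a monomial \<open>u\<close> into \<open>u\<close> or \<open>u i\<^sub>n\<^sub>+\<^sub>1\<close>, that is, into one of the pairs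
  \<open>(u, 0)\<close> and \<open>(0, u)\<close>. This recursion replaces the product formula in all later inductions.
\<close>

lemma mc_monomial_Suc:
  assumes "a (Suc n) \<in> {0, 1}"
  shows "mc_monomial (Suc n) a =
    (if a (Suc n) = 0 then Adj (mc_monomial n a) (mc_of_real n 0)
     else Adj (mc_of_real n 0) (mc_monomial n a))"
proof -
  interpret h: ring_hom_cring "MC n" "MC (Suc n)" "\<lambda>u. Adj u (mc_of_real n 0)"
    by (rule MC_Suc_embedding)
  have "mc_monomial (Suc n) a = mc_unit (Suc n) (Suc n) [^]\<^bsub>MC (Suc n)\<^esub> a (Suc n) \<otimes>\<^bsub>MC (Suc n)\<^esub>
      (\<Otimes>\<^bsub>MC (Suc n)\<^esub>k\<in>{1..n}. mc_unit (Suc n) k [^]\<^bsub>MC (Suc n)\<^esub> a k)"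
    unfolding atLeastAtMostSuc_conv[of 1 n, OF le_add2[of 1 n, unfolded Suc_eq_plus1[symmetric]]]
    by (subst h.S.finprod_insert) (auto intro!: h.S.nat_pow_closed mc_unit_closed simp del: mc_unit.simps)
  also have "(\<Otimes>\<^bsub>MC (Suc n)\<^esub>k\<in>{1..n}. mc_unit (Suc n) k [^]\<^bsub>MC (Suc n)\<^esub> a k) =
      (\<Otimes>\<^bsub>MC (Suc n)\<^esub>k\<in>{1..n}. ((\<lambda>u. Adj u (mc_of_real n 0)) \<circ> (\<lambda>k. mc_unit n k [^]\<^bsub>MC n\<^esub> a k)) k)"
  proof (rule h.S.finprod_cong')
    show "mc_unit (Suc n) k [^]\<^bsub>MC (Suc n)\<^esub> a k =
        ((\<lambda>u. Adj u (mc_of_real n 0)) \<circ> (\<lambda>k. mc_unit n k [^]\<^bsub>MC n\<^esub> a k)) k" if "k \<in> {1..n}" for k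
      using that h.hom_pow[of "mc_unit n k" "a k"] mc_unit_closed[of k n] by auto
    show "(\<lambda>u. Adj u (mc_of_real n 0)) \<circ> (\<lambda>k. mc_unit n k [^]\<^bsub>MC n\<^esub> a k) \<in> {1..n} \<rightarrow> carrier (MC (Suc n))"
      using mc_unit_closed h.R.nat_pow_closed h.hom_closed by auto
  qed simp
  also have "\<dots> = Adj (mc_monomial n a) (mc_of_real n 0)"
    by (rule h.hom_finprod[symmetric]) (auto intro!: h.R.nat_pow_closed mc_unit_closed)
  finally have split: "mc_monomial (Suc n) a = mc_unit (Suc n) (Suc n) [^]\<^bsub>MC (Suc n)\<^esub> a (Suc n) \<otimes>\<^bsub>MC (Suc n)\<^esub>
      Adj (mc_monomial n a) (mc_of_real n 0)" .
  have pow: "mc_unit (Suc n) (Suc n) [^]\<^bsub>MC (Suc n)\<^esub> a (Suc n) =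
      (if a (Suc n) = 0 then mc_of_real (Suc n) 1 else mc_unit (Suc n) (Suc n))"
    using assms h.S.nat_pow_eone[OF mc_unit_closed[of "Suc n" "Suc n"]]
    by (auto simp: MC_simps simp del: mc_unit.simps mc_of_real.simps)
  show ?thesis
    unfolding split pow using mc_monomial_closed[of n a]
    by (auto simp: MC_simps mc_zero_one_simps)
qed

lemma mc_basis_0: "mc_basis 0 = {Base 1}"
proof -
  interpret cring "MC 0" by (rule MC_cring)
  show ?thesis by (simp add: mc_basis_def MC_simps)
qed

lemma mc_basis_Suc:
  "mc_basis (Suc n) =
     (\<lambda>u. Adj u (mc_of_real n 0)) ` mc_basis n \<union> (\<lambda>u. Adj (mc_of_real n 0) u) ` mc_basis n"
proof (intro equalityI subsetI)
  fix x assume "x \<in> mc_basis (Suc n)"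
  then obtain a where "x = mc_monomial (Suc n) a" and a: "\<forall>k\<in>{1..Suc n}. a k \<in> {0, 1}"
    by (auto simp: mc_basis_def)
  moreover have "mc_monomial n a \<in> mc_basis n"
    unfolding mc_basis_def using a by (intro CollectI exI[of _ a]) auto
  ultimately show "x \<in> (\<lambda>u. Adj u (mc_of_real n 0)) ` mc_basis n \<union> (\<lambda>u. Adj (mc_of_real n 0) u) ` mc_basis n"
    using mc_monomial_Suc[of a n] by auto
next
  fix x assume "x \<in> (\<lambda>u. Adj u (mc_of_real n 0)) ` mc_basis n \<union> (\<lambda>u. Adj (mc_of_real n 0) u) ` mc_basis n"
  then obtain a e where a: "\<forall>k\<in>{1..n}. a k \<in> {0, 1}" and e: "e \<in> {0, 1::nat}"
    and x: "x = (if e = 0 then Adj (mc_monomial n a) (mc_of_real n 0)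
      else Adj (mc_of_real n 0) (mc_monomial n a))"
    unfolding mc_basis_def by (smt (verit) UnE imageE insertCI mem_Collect_eq zero_neq_one)
  interpret cring "MC n" by (rule MC_cring)
  let ?b = "a(Suc n := e)"
  have "mc_monomial n ?b = mc_monomial n a"
    by (rule finprod_cong') (auto intro!: nat_pow_closed mc_unit_closed)
  then have "x = mc_monomial (Suc n) ?b"
    unfolding x using e mc_monomial_Suc[of ?b n] by (simp only: fun_upd_same)
  moreover have "\<forall>k\<in>{1..Suc n}. ?b k \<in> {0, 1}" using a e by auto
  ultimately show "x \<in> mc_basis (Suc n)" by (auto simp: mc_basis_def)
qed

lemma mc_basis_subset: "mc_basis n \<subseteq> mc_carrier n"
  using mc_monomial_closed by (auto simp: mc_basis_def)

lemma mc_signed_basis_eq: "mc_signed_basis n = mc_basis n \<union> mc_scale (- 1) ` mc_basis n"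
  using mc_basis_subset[of n] mc_minus[of _ n] by (auto simp: mc_signed_basis_def image_iff subset_iff)

lemma mc_signed_basis_0: "mc_signed_basis 0 = {Base 1, Base (- 1)}"
  by (auto simp: mc_signed_basis_eq mc_basis_0)

lemma mc_signed_basis_Suc:
  "mc_signed_basis (Suc n) = (\<lambda>u. Adj u (mc_of_real n 0)) ` mc_signed_basis n \<union>
     (\<lambda>u. Adj (mc_of_real n 0) u) ` mc_signed_basis n"
  by (simp add: mc_signed_basis_eq mc_basis_Suc image_Un image_image mc_scale_zero Un_ac)

lemma mc_signed_basis_subset: "mc_signed_basis n \<subseteq> mc_carrier n"
  using mc_basis_subset[of n] by (auto simp: mc_signed_basis_eq mc_scale_closed)

lemma mc_signed_basis_minus: "s \<in> mc_signed_basis n \<Longrightarrow> mc_scale (- 1) s \<in> mc_signed_basis n"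
  using mc_basis_subset[of n]
  by (auto simp: mc_signed_basis_eq mc_scale_scale[of _ n] mc_scale_one[of _ n] subset_iff)

lemma mc_signed_basis_times:
  "\<lbrakk>s \<in> mc_signed_basis n; t \<in> mc_signed_basis n\<rbrakk> \<Longrightarrow> mc_times s t \<in> mc_signed_basis n"
proof (induction n arbitrary: s t)
  case (Suc n)
  have car: "u \<in> mc_carrier n" if "u \<in> mc_signed_basis n" for u
    using that mc_signed_basis_subset by blast
  show ?case
    using Suc.prems Suc.IH car mc_signed_basis_minus
    by (auto simp: mc_signed_basis_Suc mc_zero_one_simps mc_times_closed mc_scale_closed)
qed (auto simp: mc_signed_basis_0)

lemma mc_of_real_minus: "mc_scale (- 1) (mc_of_real n r) = mc_of_real n (- r)"
  by (induction n arbitrary: r) auto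

lemma mc_of_real_inject: "mc_of_real n r = mc_of_real n s \<longleftrightarrow> r = s"
  by (induction n arbitrary: r s) auto

lemma mc_signed_basis_square:
  "s \<in> mc_signed_basis n \<Longrightarrow> mc_times s s \<in> {mc_of_real n 1, mc_of_real n (- 1)}"
proof (induction n arbitrary: s)
  case (Suc n)
  then obtain u where u: "u \<in> mc_signed_basis n"
    and s: "s = Adj u (mc_of_real n 0) \<or> s = Adj (mc_of_real n 0) u"
    by (auto simp: mc_signed_basis_Suc)
  have "u \<in> mc_carrier n" using u mc_signed_basis_subset by blast
  then show ?case
    using s Suc.IH[OF u]
    by (auto simp: mc_zero_one_simps mc_times_closed mc_scale_closed mc_of_real_minus)
qed (auto simp: mc_signed_basis_0)

lemma mc_one_in_signed_basis: "mc_of_real n 1 \<in> mc_signed_basis n"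
  by (induction n) (auto simp: mc_signed_basis_0 mc_signed_basis_Suc)

lemma mc_unit_in_signed_basis: "\<lbrakk>1 \<le> k; k \<le> n\<rbrakk> \<Longrightarrow> mc_unit n k \<in> mc_signed_basis n"
proof (induction n)
  case (Suc n)
  then show ?case
    using mc_one_in_signed_basis[of n] by (cases "k = Suc n") (auto simp: mc_signed_basis_Suc)
qed simp

lemma mc_zero_notin_signed_basis: "mc_of_real n 0 \<notin> mc_signed_basis n"
  by (induction n) (auto simp: mc_signed_basis_0 mc_signed_basis_Suc)

lemma card_mc_signed_basis: "card (mc_signed_basis n) = 2 ^ Suc n"
proof (induction n)
  case (Suc n)
  have "finite (mc_signed_basis n)" using Suc by (intro card_ge_0_finite) simp
  moreover have "(\<lambda>u. Adj u (mc_of_real n 0)) ` mc_signed_basis n \<inter>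
      (\<lambda>u. Adj (mc_of_real n 0) u) ` mc_signed_basis n = {}"
    using mc_zero_notin_signed_basis[of n] by auto
  ultimately show ?case
    unfolding mc_signed_basis_Suc
    by (subst card_Un_disjoint) (simp_all add: card_image inj_on_def Suc)
qed (simp add: mc_signed_basis_0)

section \<open>Linear maps between multicomplex algebras\<close>

text \<open>
  This is the spanning property of the monomials, in the form of an induction rule.
\<close>

lemma mc_basis_span_induct [consumes 1, case_names basis plus scale]:
  assumes "x \<in> mc_carrier n"
    and "\<And>u. u \<in> mc_basis n \<Longrightarrow> P u"
    and "\<And>x y. \<lbrakk>x \<in> mc_carrier n; y \<in> mc_carrier n; P x; P y\<rbrakk> \<Longrightarrow> P (mc_plus x y)"
    and "\<And>c x. \<lbrakk>x \<in> mc_carrier n; P x\<rbrakk> \<Longrightarrow> P (mc_scale c x)"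
  shows "P x"
  using assms
proof (induction n arbitrary: x P)
  case 0
  then obtain r where "x = mc_scale r (Base 1)" by auto
  moreover have "P (Base 1)" using 0 by (simp add: mc_basis_0)
  ultimately show ?case using "0.prems"(4) by fastforce
next
  case (Suc n)
  let ?z = "mc_of_real n 0"
  obtain a b where x: "x = Adj a b" and a: "a \<in> mc_carrier n" and b: "b \<in> mc_carrier n"
    using Suc.prems(1) by auto
  note basis = Suc.prems(2) and plus = Suc.prems(3) and scale = Suc.prems(4)
  have "P (Adj a ?z)"
    using a
  proof (rule Suc.IH)
    show "P (Adj (mc_plus u v) ?z)"
      if "u \<in> mc_carrier n" "v \<in> mc_carrier n" "P (Adj u ?z)" "P (Adj v ?z)" for u v
      using plus[of "Adj u ?z" "Adj v ?z"] that by (simp add: mc_zero_one_simps)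
    show "P (Adj (mc_scale c u) ?z)" if "u \<in> mc_carrier n" "P (Adj u ?z)" for c u
      using scale[of "Adj u ?z" c] that by (simp add: mc_zero_one_simps)
  qed (simp add: basis mc_basis_Suc)
  moreover have "P (Adj ?z b)"
    using b
  proof (rule Suc.IH)
    show "P (Adj ?z (mc_plus u v))"
      if "u \<in> mc_carrier n" "v \<in> mc_carrier n" "P (Adj ?z u)" "P (Adj ?z v)" for u v
      using plus[of "Adj ?z u" "Adj ?z v"] that by (simp add: mc_zero_one_simps)
    show "P (Adj ?z (mc_scale c u))" if "u \<in> mc_carrier n" "P (Adj ?z u)" for c u
      using scale[of "Adj ?z u" c] that by (simp add: mc_zero_one_simps)
  qed (simp add: basis mc_basis_Suc)
  ultimately show ?case
    using plus[of "Adj a ?z" "Adj ?z b"] a b by (simp add: x mc_zero_one_simps)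
qed

definition mc_linear :: "nat \<Rightarrow> nat \<Rightarrow> (mc \<Rightarrow> mc) \<Rightarrow> bool" where
  "mc_linear n m F \<longleftrightarrow> (\<forall>x\<in>mc_carrier n. F x \<in> mc_carrier m) \<and>
    (\<forall>x\<in>mc_carrier n. \<forall>y\<in>mc_carrier n. F (mc_plus x y) = mc_plus (F x) (F y)) \<and>
    (\<forall>c. \<forall>x\<in>mc_carrier n. F (mc_scale c x) = mc_scale c (F x))"

lemma mc_linearI:
  assumes "\<And>x. x \<in> mc_carrier n \<Longrightarrow> F x \<in> mc_carrier m"
    and "\<And>x y. \<lbrakk>x \<in> mc_carrier n; y \<in> mc_carrier n\<rbrakk> \<Longrightarrow> F (mc_plus x y) = mc_plus (F x) (F y)"
    and "\<And>c x. x \<in> mc_carrier n \<Longrightarrow> F (mc_scale c x) = mc_scale c (F x)"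
  shows "mc_linear n m F"
  using assms by (simp add: mc_linear_def)

lemma mc_linearD:
  assumes "mc_linear n m F" "x \<in> mc_carrier n"
  shows "F x \<in> mc_carrier m" "y \<in> mc_carrier n \<Longrightarrow> F (mc_plus x y) = mc_plus (F x) (F y)"
    "F (mc_scale c x) = mc_scale c (F x)"
  using assms by (simp_all add: mc_linear_def)

lemma mc_linear_zero: "mc_linear n m F \<Longrightarrow> F (mc_of_real n 0) = mc_of_real m 0"
  using mc_linearD(3)[of n m F "mc_of_real n 0" 0] mc_linearD(1)[of n m F "mc_of_real n 0"]
  by (simp add: mc_of_real_closed mc_scale_zero mc_zero_scale)

lemma mc_linear_eqI:
  assumes "mc_linear n m F" "mc_linear n m H" "\<And>u. u \<in> mc_basis n \<Longrightarrow> F u = H u"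
    and "x \<in> mc_carrier n"
  shows "F x = H x"
  using assms(4)
  by (induction rule: mc_basis_span_induct)
    (simp_all add: assms(3) mc_linearD[OF assms(1)] mc_linearD[OF assms(2)])

text \<open>
  Linear independence of the monomials enters here: on a pair \<open>(a, b)\<close> the extension is the sum of the
  extensions belonging to the monomials \<open>(u, 0)\<close> and \<open>(0, u)\<close>.
\<close>

lemma mc_linear_extension_exists:
  assumes "\<phi> ` mc_basis n \<subseteq> mc_carrier m"
  shows "\<exists>F. mc_linear n m F \<and> (\<forall>u\<in>mc_basis n. F u = \<phi> u)"
  using assms
proof (induction n arbitrary: \<phi>)
  case 0
  then have "\<phi> (Base 1) \<in> mc_carrier m" by (simp add: mc_basis_0)
  then show ?case
    by (intro exI[of _ "case_mc (\<lambda>r. mc_scale r (\<phi> (Base 1))) undefined"])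
      (auto simp: mc_basis_0 mc_scale_closed mc_scale_add mc_scale_scale mc_scale_one intro!: mc_linearI)
next
  case (Suc n)
  let ?z = "mc_of_real n 0"
  have \<phi>: "(\<lambda>u. \<phi> (Adj u ?z)) ` mc_basis n \<subseteq> mc_carrier m" "(\<lambda>u. \<phi> (Adj ?z u)) ` mc_basis n \<subseteq> mc_carrier m"
    using Suc.prems unfolding mc_basis_Suc image_Un image_image Un_subset_iff by blast+
  obtain F where F: "mc_linear n m F" "\<And>u. u \<in> mc_basis n \<Longrightarrow> F u = \<phi> (Adj u ?z)"
    using Suc.IH[OF \<phi>(1)] by blast
  obtain H where H: "mc_linear n m H" "\<And>u. u \<in> mc_basis n \<Longrightarrow> H u = \<phi> (Adj ?z u)"
    using Suc.IH[OF \<phi>(2)] by blast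
  note FH = mc_linearD[OF F(1)] mc_linearD[OF H(1)]
  let ?G = "case_mc undefined (\<lambda>a b. mc_plus (F a) (H b))"
  have "mc_linear (Suc n) m ?G"
    by (rule mc_linearI)
      (auto simp: FH mc_plus_closed mc_scale_plus[of _ m] mc_plus_assoc[of _ m] mc_plus_left_commute[of _ m])
  moreover have "?G u = \<phi> u" if "u \<in> mc_basis (Suc n)" for u
  proof -
    have "F v \<in> mc_carrier m" "H v \<in> mc_carrier m" if "v \<in> mc_basis n" for v
      using that FH mc_basis_subset by blast+
    then show ?thesis
      using that F(2) H(2)
      by (auto simp: mc_basis_Suc mc_linear_zero[OF F(1)] mc_linear_zero[OF H(1)]
          mc_plus_zero[of _ m] mc_plus_zero_right[of _ m])
  qed
  ultimately show ?case by blast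
qed

lemma mc_linear_id: "mc_linear n n (\<lambda>x. x)"
  by (simp add: mc_linear_def)

lemma mc_linear_compose: "\<lbrakk>mc_linear n m F; mc_linear m l H\<rbrakk> \<Longrightarrow> mc_linear n l (\<lambda>x. H (F x))"
  by (simp add: mc_linear_def)

lemma mc_linear_times: "a \<in> mc_carrier n \<Longrightarrow> mc_linear n n (\<lambda>x. mc_times a x)"
  by (intro mc_linearI mc_times_closed mc_distrib_right mc_times_scale_right)

text \<open>
  Both sides are linear in each argument, so the monomials determine them in one argument at a time.
\<close>

lemma mc_linear_mult:
  assumes F: "mc_linear n m F"
    and basis: "\<And>u v. \<lbrakk>u \<in> mc_basis n; v \<in> mc_basis n\<rbrakk> \<Longrightarrow> F (mc_times u v) = mc_times (F u) (F v)"
    and "x \<in> mc_carrier n" "y \<in> mc_carrier n"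
  shows "F (mc_times x y) = mc_times (F x) (F y)"
proof -
  have car: "u \<in> mc_carrier n" if "u \<in> mc_basis n" for u
    using that mc_basis_subset by blast
  have linear: "mc_linear n m (\<lambda>v. F (mc_times a v))" "mc_linear n m (\<lambda>v. mc_times (F a) (F v))"
    if "a \<in> mc_carrier n" for a
    using mc_linear_compose[OF mc_linear_times[OF that] F]
      mc_linear_compose[OF F mc_linear_times[OF mc_linearD(1)[OF F that]]] .
  have one_sided: "F (mc_times u z) = mc_times (F u) (F z)"
    if "u \<in> mc_basis n" "z \<in> mc_carrier n" for u z
    using linear[OF car[OF that(1)]] basis[OF that(1)] that(2) by (rule mc_linear_eqI)
  show ?thesis
    using linear[OF assms(3)]
  proof (rule mc_linear_eqI)
    fix v assume v: "v \<in> mc_basis n"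
    have "F (mc_times x v) = F (mc_times v x)" using mc_times_commute car v assms(3) by metis
    also have "\<dots> = mc_times (F x) (F v)"
      using one_sided[OF v assms(3)] mc_times_commute mc_linearD(1)[OF F] car v assms(3) by metis
    finally show "F (mc_times x v) = mc_times (F x) (F v)" .
  qed (rule assms(4))
qed

lemma basis_preserving_involutions_iff:
  "f \<in> basis_preserving_involutions n \<longleftrightarrow>
     f \<in> extensional (mc_carrier n) \<and> mc_linear n n f \<and>
     (\<forall>x\<in>mc_carrier n. \<forall>y\<in>mc_carrier n. f (mc_times x y) = mc_times (f x) (f y)) \<and>
     (\<forall>x\<in>mc_carrier n. f (f x) = x) \<and> f ` mc_basis n \<subseteq> mc_signed_basis n"
  unfolding basis_preserving_involutions_def algebra_involution_def mc_linear_def MC_simps PiE_def Pi_iff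
  by auto

section \<open>Involutions and their restrictions to square roots of one\<close>

text \<open>
  The parameter \<open>R\<close> only serves to write the operations of \<open>MC n\<close> without subscripts.
\<close>

locale multicomplex = cring R for R :: "(real, mc) module" (structure) +
  fixes n :: nat
  assumes R_eq: "R = MC n" and n_pos: "1 \<le> n"
begin

abbreviation S :: "mc set" where "S \<equiv> mc_signed_basis n"

definition i1 :: mc where "i1 = mc_unit n 1"

text \<open>
  This group contains \<open>-1\<close> and all products \<open>i\<^sub>j i\<^sub>k\<close>. It carries the linear algebra over the field with
  two elements.
\<close>

definition T :: "mc set" where "T = {s \<in> S. s \<otimes> s = \<one>}"

lemma carrier_eq: "carrier R = mc_carrier n"
  by (simp add: R_eq MC_simps)

lemma S_closed: "s \<in> S \<Longrightarrow> s \<in> carrier R"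
  using mc_signed_basis_subset by (auto simp: carrier_eq)

lemma S_one: "\<one> \<in> S"
  using mc_one_in_signed_basis by (simp add: R_eq MC_simps)

lemma S_mult: "\<lbrakk>s \<in> S; t \<in> S\<rbrakk> \<Longrightarrow> s \<otimes> t \<in> S"
  using mc_signed_basis_times by (simp add: R_eq MC_simps)

lemma minus_eq_scale: "x \<in> carrier R \<Longrightarrow> \<ominus> x = mc_scale (- 1) x"
  using mc_minus by (simp add: R_eq MC_simps)

lemma S_minus: "s \<in> S \<Longrightarrow> \<ominus> s \<in> S"
  using mc_signed_basis_minus by (simp add: minus_eq_scale S_closed)

lemma S_square: "s \<in> S \<Longrightarrow> s \<otimes> s = \<one> \<or> s \<otimes> s = \<ominus> \<one>"
  using mc_signed_basis_square[of s n] minus_eq_scale[OF one_closed]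
  by (simp add: R_eq MC_simps mc_of_real_minus)

lemma one_neq_minus_one: "\<ominus> \<one> \<noteq> \<one>"
  unfolding minus_eq_scale[OF one_closed] by (simp add: R_eq MC_simps mc_of_real_minus mc_of_real_inject)

lemma i1_in_S: "i1 \<in> S"
  unfolding i1_def using mc_unit_in_signed_basis n_pos by blast

lemma i1_closed: "i1 \<in> carrier R"
  using i1_in_S by (rule S_closed)

lemma i1_square: "i1 \<otimes> i1 = \<ominus> \<one>"
  unfolding i1_def R_eq using mc_unit_square n_pos by blast

lemma i1_i1_mult: "x \<in> carrier R \<Longrightarrow> i1 \<otimes> (i1 \<otimes> x) = \<ominus> x"
  by (simp add: m_assoc[symmetric] i1_closed i1_square l_minus)

lemma T_subset: "T \<subseteq> S"
  by (auto simp: T_def)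

lemma T_closed: "t \<in> T \<Longrightarrow> t \<in> carrier R"
  using T_subset S_closed by blast

lemma T_square: "t \<in> T \<Longrightarrow> t \<otimes> t = \<one>"
  by (simp add: T_def)

lemma T_one: "\<one> \<in> T"
  by (simp add: T_def S_one)

lemma square_mult: "\<lbrakk>s \<in> carrier R; t \<in> carrier R\<rbrakk> \<Longrightarrow> s \<otimes> t \<otimes> (s \<otimes> t) = (s \<otimes> s) \<otimes> (t \<otimes> t)"
  by (simp add: m_ac)

lemma T_mult: "\<lbrakk>s \<in> T; t \<in> T\<rbrakk> \<Longrightarrow> s \<otimes> t \<in> T"
  by (simp add: T_def S_mult square_mult S_closed)

lemma T_minus: "t \<in> T \<Longrightarrow> \<ominus> t \<in> T"
  by (simp add: T_def S_minus S_closed l_minus r_minus)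

lemma i1_mult_square: "x \<in> carrier R \<Longrightarrow> i1 \<otimes> x \<otimes> (i1 \<otimes> x) = \<ominus> (x \<otimes> x)"
  by (simp add: square_mult[of i1 x] i1_closed i1_square l_minus)

lemma i1_mult_notin_T: "t \<in> T \<Longrightarrow> i1 \<otimes> t \<notin> T"
  using one_neq_minus_one by (auto simp: T_def i1_mult_square S_closed)

text \<open>
  If \<open>s\<close> has square \<open>-1\<close>, then \<open>- i\<^sub>1 s\<close> has square \<open>1\<close>, and \<open>s = i\<^sub>1 (- i\<^sub>1 s)\<close>.
\<close>

lemma S_cases:
  assumes "s \<in> S"
  obtains "s \<in> T" | t where "t \<in> T" "s = i1 \<otimes> t"
proof (cases "s \<in> T")
  case False
  then have "s \<otimes> s = \<ominus> \<one>" using assms S_square by (auto simp: T_def)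
  then have "\<ominus> (i1 \<otimes> s) \<in> T"
    using assms by (simp add: T_def S_minus S_mult i1_in_S S_closed i1_closed l_minus r_minus
        i1_mult_square)
  moreover have "s = i1 \<otimes> \<ominus> (i1 \<otimes> s)"
    using assms by (simp add: r_minus i1_i1_mult S_closed i1_closed)
  ultimately show thesis by (rule that(2))
qed (rule that(1))

lemma card_T: "card T = 2 ^ n"
proof -
  have inj: "inj_on (\<lambda>t. i1 \<otimes> t) T"
  proof (rule inj_onI)
    fix s t assume "s \<in> T" "t \<in> T" "i1 \<otimes> s = i1 \<otimes> t"
    then have "i1 \<otimes> (i1 \<otimes> s) = i1 \<otimes> (i1 \<otimes> t)" by simp
    then show "s = t" using \<open>s \<in> T\<close> \<open>t \<in> T\<close>
      by (metis T_closed i1_i1_mult minus_minus)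
  qed
  have "S = T \<union> (\<lambda>t. i1 \<otimes> t) ` T"
    using S_cases T_subset S_mult i1_in_S by blast
  moreover have "T \<inter> (\<lambda>t. i1 \<otimes> t) ` T = {}"
    using i1_mult_notin_T by blast
  moreover have "finite S" using card_mc_signed_basis[of n] by (intro card_ge_0_finite) simp
  then have "finite T" using T_subset by (rule finite_subset[rotated])
  ultimately have "card S = 2 * card T"
    using card_Un_disjoint[of T "(\<lambda>t. i1 \<otimes> t) ` T"] card_image[OF inj] by simp
  then show ?thesis using card_mc_signed_basis[of n] by simp
qed

sublocale T: elementary_abelian_2_group "R\<lparr>carrier := T\<rparr>"
proof -
  have "comm_group (R\<lparr>carrier := T\<rparr>)"
  proof (rule comm_groupI)
    fix x assume "x \<in> carrier (R\<lparr>carrier := T\<rparr>)"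
    then show "\<exists>y\<in>carrier (R\<lparr>carrier := T\<rparr>). y \<otimes>\<^bsub>R\<lparr>carrier := T\<rparr>\<^esub> x = \<one>\<^bsub>R\<lparr>carrier := T\<rparr>\<^esub>"
      using T_square by auto
  qed (auto simp: T_mult T_one T_closed intro: m_assoc m_comm)
  then show "elementary_abelian_2_group (R\<lparr>carrier := T\<rparr>)"
    by (intro elementary_abelian_2_group.intro elementary_abelian_2_group_axioms.intro)
      (simp_all add: T_square)
qed

lemma fixing_involutions_iff:
  "g \<in> T.fixing_involutions (\<ominus> \<one>) \<longleftrightarrow> g \<in> extensional T \<and> (\<forall>s\<in>T. g s \<in> T) \<and>
     (\<forall>s\<in>T. \<forall>t\<in>T. g (s \<otimes> t) = g s \<otimes> g t) \<and> g (\<ominus> \<one>) = \<ominus> \<one> \<and> (\<forall>s\<in>T. g (g s) = s)"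
  by (auto simp: T.fixing_involutions_def hom_def)

text \<open>
  As \<open>- i\<^sub>1\<close> is the inverse of \<open>i\<^sub>1\<close>, the second component is the \<open>t\<close> with \<open>f(i\<^sub>1) = i\<^sub>1 t\<close>.
\<close>

definition restriction_pair :: "(mc \<Rightarrow> mc) \<Rightarrow> (mc \<Rightarrow> mc) \<times> mc" where
  "restriction_pair f = (restrict f T, \<ominus> (i1 \<otimes> f i1))"

lemma mc_basis_subset_S: "mc_basis n \<subseteq> S"
  by (auto simp: mc_signed_basis_eq)

context
  fixes f assumes f: "f \<in> basis_preserving_involutions n"
begin

lemma involution_ext: "f \<in> extensional (carrier R)" and involution_linear: "mc_linear n n f"
  and involution_mult: "\<lbrakk>x \<in> carrier R; y \<in> carrier R\<rbrakk> \<Longrightarrow> f (x \<otimes> y) = f x \<otimes> f y"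
  and involution_twice: "x \<in> carrier R \<Longrightarrow> f (f x) = x"
  using f unfolding basis_preserving_involutions_iff carrier_eq by (auto simp: R_eq MC_simps)

lemma involution_closed: "x \<in> carrier R \<Longrightarrow> f x \<in> carrier R"
  using mc_linearD(1)[OF involution_linear] by (simp add: carrier_eq)

lemma involution_minus: "x \<in> carrier R \<Longrightarrow> f (\<ominus> x) = \<ominus> (f x)"
  using mc_linearD(3)[OF involution_linear] involution_closed by (simp add: minus_eq_scale) (simp add: carrier_eq)

lemma involution_one: "f \<one> = \<one>"
  using involution_mult[of \<one> "f \<one>"] involution_twice[of \<one>] involution_closed[of \<one>] by simp

lemma involution_S: "s \<in> S \<Longrightarrow> f s \<in> S"
proof -
  assume "s \<in> S"
  then consider "s \<in> mc_basis n" | u where "u \<in> mc_basis n" "s = \<ominus> u"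
    using mc_basis_subset_S by (auto simp: mc_signed_basis_eq minus_eq_scale S_closed subset_iff)
  then show "f s \<in> S"
  proof cases
    case 2
    then have "f u \<in> S" "u \<in> carrier R"
      using f mc_basis_subset_S S_closed by (auto simp: basis_preserving_involutions_iff)
    then show ?thesis using 2 by (simp add: involution_minus S_minus)
  qed (use f in \<open>auto simp: basis_preserving_involutions_iff\<close>)
qed

lemma involution_T: "t \<in> T \<Longrightarrow> f t \<in> T"
  using involution_mult[of t t] by (auto simp: T_def involution_S S_closed involution_one)

text \<open>
  The square of \<open>f(i\<^sub>1)\<close> is \<open>f(-1) = -1\<close>, hence \<open>t = - i\<^sub>1 f(i\<^sub>1)\<close> has square \<open>1\<close>; and \<open>f\<close> fixes \<open>t\<close>
  because it swaps \<open>i\<^sub>1\<close> and \<open>f(i\<^sub>1)\<close>.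
\<close>

lemma restriction_pair_in:
  "restriction_pair f \<in> (SIGMA g:T.fixing_involutions (\<ominus> \<one>). T.fixed_points g)"
proof -
  have "f i1 \<otimes> f i1 = \<ominus> \<one>"
    using involution_mult[OF i1_closed i1_closed] by (simp add: i1_square involution_minus involution_one)
  then have t: "\<ominus> (i1 \<otimes> f i1) \<in> T"
    using i1_in_S involution_S[OF i1_in_S] S_closed
    by (simp add: T_def S_minus S_mult l_minus r_minus i1_mult_square)
  moreover have "f (\<ominus> (i1 \<otimes> f i1)) = \<ominus> (i1 \<otimes> f i1)"
    using i1_closed involution_closed involution_twice involution_mult by (simp add: involution_minus m_comm)
  moreover have "restrict f T \<in> T.fixing_involutions (\<ominus> \<one>)"
    using T_one T_minus involution_T involution_mult involution_twice T_mult T_closed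
    by (simp add: fixing_involutions_iff involution_minus involution_one)
  ultimately show ?thesis by (simp add: restriction_pair_def)
qed

lemma involution_i1: "f i1 = i1 \<otimes> snd (restriction_pair f)"
  using i1_closed involution_closed by (simp add: restriction_pair_def r_minus i1_i1_mult)

end

lemma inj_on_restriction_pair: "inj_on restriction_pair (basis_preserving_involutions n)"
proof (rule inj_onI)
  fix f h assume f: "f \<in> basis_preserving_involutions n" and h: "h \<in> basis_preserving_involutions n"
    and eq: "restriction_pair f = restriction_pair h"
  have eqT: "f t = h t" if "t \<in> T" for t
    using eq that unfolding restriction_pair_def by (metis prod.inject restrict_apply')
  have eq_i1: "f i1 = h i1" using involution_i1[OF f] involution_i1[OF h] eq by simp
  have eqS: "f s = h s" if "s \<in> S" for s
    using that
  proof (cases rule: S_cases)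
    case (2 t)
    then show ?thesis
      using eqT eq_i1 involution_mult[OF f] involution_mult[OF h] i1_closed T_closed by simp
  qed (rule eqT)
  show "f = h"
  proof (rule extensionalityI[OF involution_ext[OF f] involution_ext[OF h]])
    fix x assume "x \<in> carrier R"
    then show "f x = h x"
      using mc_linear_eqI[OF involution_linear[OF f] involution_linear[OF h]] eqS mc_basis_subset_S
      by (auto simp: carrier_eq)
  qed
qed

text \<open>
  On the signed monomials the involution must be \<open>g\<close> on \<open>T\<close> and \<open>i\<^sub>1 a \<mapsto> i\<^sub>1 t g(a)\<close> on the complement. This
  map \<open>\<phi>\<close> is multiplicative because \<open>(i\<^sub>1 t)\<^sup>2 = i\<^sub>1\<^sup>2\<close>, and involutive because \<open>t g(t) = t\<^sup>2 = 1\<close>. It commutes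
  with the sign, so its linear extension from the monomials agrees with it on the negative ones too.
\<close>

lemma restriction_pair_surj:
  assumes g: "g \<in> T.fixing_involutions (\<ominus> \<one>)" and t: "t \<in> T" "g t = t"
  shows "\<exists>f\<in>basis_preserving_involutions n. restriction_pair f = (g, t)"
proof -
  have g_ext: "g \<in> extensional T" and g_T: "\<And>s. s \<in> T \<Longrightarrow> g s \<in> T"
    and g_mult: "\<And>s r. \<lbrakk>s \<in> T; r \<in> T\<rbrakk> \<Longrightarrow> g (s \<otimes> r) = g s \<otimes> g r"
    and g_minus_one: "g (\<ominus> \<one>) = \<ominus> \<one>" and g_g: "\<And>s. s \<in> T \<Longrightarrow> g (g s) = s"
    using g by (auto simp: fixing_involutions_iff)
  have g_closed: "g s \<in> carrier R" if "s \<in> T" for s using g_T[OF that] by (rule T_closed)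
  have g_minus: "g (\<ominus> s) = \<ominus> (g s)" if "s \<in> T" for s
    using g_mult[OF T_minus[OF T_one] that] that
    by (simp add: g_minus_one l_minus T_closed g_closed)
  have g_one: "g \<one> = \<one>"
    using g_minus[OF T_one] by (simp add: g_minus_one) (metis g_closed T_one minus_minus one_closed)
  \<comment> \<open>in the second case \<open>- i\<^sub>1 s\<close> is the \<open>a\<close> in \<open>T\<close> with \<open>s = i\<^sub>1 a\<close>\<close>
  define \<phi> where "\<phi> s = (if s \<in> T then g s else i1 \<otimes> (t \<otimes> g (\<ominus> (i1 \<otimes> s))))" for s
  have \<phi>_T: "\<phi> s = g s" if "s \<in> T" for s
    using that by (simp add: \<phi>_def)
  have \<phi>_i1: "\<phi> (i1 \<otimes> s) = i1 \<otimes> (t \<otimes> g s)" if "s \<in> T" for s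
    using i1_mult_notin_T[OF that] that by (simp add: \<phi>_def i1_i1_mult T_closed)
  have \<phi>_S: "\<phi> s \<in> S" if "s \<in> S" for s
    using that
  proof (cases rule: S_cases)
    case 1
    then show ?thesis using g_T T_subset by (auto simp: \<phi>_T)
  next
    case (2 r)
    then show ?thesis using g_T T_subset t i1_in_S by (auto simp: \<phi>_i1 intro!: S_mult)
  qed
  have \<phi>_minus: "\<phi> (\<ominus> s) = \<ominus> (\<phi> s)" if "s \<in> S" for s
    using that
  proof (cases rule: S_cases)
    case 1
    then show ?thesis by (simp add: \<phi>_T T_minus g_minus)
  next
    case (2 r)
    then have minus_s: "\<ominus> s = i1 \<otimes> (\<ominus> r)" by (simp add: r_minus i1_closed T_closed)
    have "\<phi> (\<ominus> s) = i1 \<otimes> (t \<otimes> \<ominus> (g r))"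
      unfolding minus_s using 2 by (simp add: \<phi>_i1 T_minus g_minus)
    then show ?thesis
      using 2 t by (simp add: \<phi>_i1 r_minus i1_closed T_closed g_closed)
  qed
  have \<phi>_\<phi>: "\<phi> (\<phi> s) = s" if "s \<in> S" for s
    using that
  proof (cases rule: S_cases)
    case 1
    then show ?thesis by (simp add: \<phi>_T g_T g_g)
  next
    case (2 r)
    then show ?thesis
      by (simp add: \<phi>_i1 T_mult g_T g_g g_mult t m_assoc[symmetric] T_closed T_square)
  qed
  have \<phi>_mixed: "\<phi> (r \<otimes> (i1 \<otimes> s)) = \<phi> r \<otimes> \<phi> (i1 \<otimes> s)" if "r \<in> T" "s \<in> T" for r s
  proof -
    have swap: "r \<otimes> (i1 \<otimes> s) = i1 \<otimes> (r \<otimes> s)"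
      using that by (simp add: m_lcomm T_closed i1_closed)
    have "\<phi> (r \<otimes> (i1 \<otimes> s)) = i1 \<otimes> (t \<otimes> (g r \<otimes> g s))"
      unfolding swap using that by (simp add: \<phi>_i1 T_mult g_mult)
    also have "\<dots> = g r \<otimes> (i1 \<otimes> (t \<otimes> g s))"
      using that t by (simp add: g_closed T_closed i1_closed m_ac)
    finally show ?thesis using that by (simp add: \<phi>_i1 \<phi>_T)
  qed
  have \<phi>_mult: "\<phi> (s \<otimes> r) = \<phi> s \<otimes> \<phi> r" if s: "s \<in> S" and r: "r \<in> S" for s r
    using s
  proof (cases rule: S_cases)
    case s1: 1
    show ?thesis
      using r
    proof (cases rule: S_cases)
      case 1
      then show ?thesis using s1 by (simp add: \<phi>_T T_mult g_mult)
    next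
      case (2 b)
      then show ?thesis using s1 \<phi>_mixed by simp
    qed
  next
    case s2: (2 a)
    show ?thesis
      using r
    proof (cases rule: S_cases)
      case 1
      then show ?thesis
        using s2 \<phi>_mixed[of r a] m_comm[OF S_closed[OF s] S_closed[OF r]]
          m_comm[OF S_closed[OF \<phi>_S[OF s]] S_closed[OF \<phi>_S[OF r]]] by simp
    next
      case (2 b)
      have "s \<otimes> r = (i1 \<otimes> i1) \<otimes> (a \<otimes> b)"
        using s2 2 by (simp add: m_ac T_closed i1_closed)
      then have "\<phi> (s \<otimes> r) = \<ominus> (g a \<otimes> g b)"
        using s2 2 by (simp add: i1_square l_minus T_closed T_mult T_minus \<phi>_T g_minus g_mult)
      also have "\<dots> = (i1 \<otimes> i1) \<otimes> (t \<otimes> t) \<otimes> (g a \<otimes> g b)"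
        using s2 2 t by (simp add: i1_square T_square l_minus g_closed)
      also have "\<dots> = i1 \<otimes> (t \<otimes> g a) \<otimes> (i1 \<otimes> (t \<otimes> g b))"
        using s2 2 t by (simp add: m_ac T_closed i1_closed g_closed)
      finally show ?thesis using s2 2 by (simp add: \<phi>_i1)
    qed
  qed
  have \<phi>_carrier: "\<phi> ` mc_basis n \<subseteq> mc_carrier n"
    using \<phi>_S mc_basis_subset_S mc_signed_basis_subset by blast
  obtain F where F: "mc_linear n n F" and F_basis: "\<And>u. u \<in> mc_basis n \<Longrightarrow> F u = \<phi> u"
    using mc_linear_extension_exists[OF \<phi>_carrier] by blast
  have F_S: "F s = \<phi> s" if s: "s \<in> S" for s
  proof (cases "s \<in> mc_basis n")
    case False
    then obtain u where u: "u \<in> mc_basis n" "s = mc_scale (- 1) u"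
      using s by (auto simp: mc_signed_basis_eq)
    then have uS: "u \<in> S" using mc_basis_subset_S by blast
    then have "s = \<ominus> u" using u by (simp add: minus_eq_scale S_closed)
    then have "\<phi> s = mc_scale (- 1) (\<phi> u)"
      using \<phi>_minus[OF uS] minus_eq_scale[OF S_closed[OF \<phi>_S[OF uS]]] by (simp only:)
    moreover have "F s = mc_scale (- 1) (F u)"
      using u mc_linearD(3)[OF F] mc_basis_subset by blast
    ultimately show ?thesis
      using F_basis[OF u(1)] by (simp only:)
  qed (rule F_basis)
  have F_mult: "F (mc_times x y) = mc_times (F x) (F y)" if "x \<in> mc_carrier n" "y \<in> mc_carrier n" for x y
    using F _ that
  proof (rule mc_linear_mult)
    fix u v assume "u \<in> mc_basis n" "v \<in> mc_basis n"
    then have "u \<in> S" "v \<in> S" using mc_basis_subset_S by auto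
    then show "F (mc_times u v) = mc_times (F u) (F v)"
      using \<phi>_mult[of u v] S_mult[of u v] by (simp add: F_S R_eq MC_simps)
  qed
  have F_F: "F (F x) = x" if "x \<in> mc_carrier n" for x
    using mc_linear_compose[OF F F] mc_linear_id _ that
  proof (rule mc_linear_eqI)
    fix u assume "u \<in> mc_basis n"
    then have "u \<in> S" using mc_basis_subset_S by auto
    then show "F (F u) = u" by (simp add: F_S \<phi>_S \<phi>_\<phi>)
  qed
  define f where "f = restrict F (mc_carrier n)"
  have "f \<in> basis_preserving_involutions n"
    unfolding basis_preserving_involutions_iff
  proof (intro conjI ballI)
    show "mc_linear n n f"
      using F by (simp add: f_def mc_linear_def mc_plus_closed mc_scale_closed)
    show "f ` mc_basis n \<subseteq> S"
      using F_S \<phi>_S mc_basis_subset_S mc_basis_subset by (auto simp: f_def subset_iff)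
  qed (simp_all add: f_def F_mult F_F mc_linearD(1)[OF F] mc_times_closed)
  moreover have f_S: "f s = \<phi> s" if "s \<in> S" for s
    using that F_S S_closed by (simp add: f_def carrier_eq)
  have "restriction_pair f = (g, t)"
  proof -
    have "restrict f T = g"
      using g_ext T_subset f_S \<phi>_T by (intro extensionalityI[of _ T]) auto
    moreover have "f i1 = i1 \<otimes> t"
      using \<phi>_i1[OF T_one] f_S[OF i1_in_S] t by (simp add: g_one i1_closed T_closed)
    ultimately show ?thesis
      using t by (simp add: restriction_pair_def i1_i1_mult T_closed)
  qed
  ultimately show ?thesis by blast
qed

lemma card_basis_preserving_involutions:
  "card (basis_preserving_involutions n) =
     (\<Sum>g\<in>T.fixing_involutions (\<ominus> \<one>). card (T.fixed_points g))"
proof -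
  let ?P = "SIGMA g:T.fixing_involutions (\<ominus> \<one>). T.fixed_points g"
  have "restriction_pair ` basis_preserving_involutions n = ?P"
  proof (intro equalityI subsetI)
    fix p assume "p \<in> ?P"
    then obtain g t where "p = (g, t)" "g \<in> T.fixing_involutions (\<ominus> \<one>)" "t \<in> T" "g t = t"
      by auto
    then show "p \<in> restriction_pair ` basis_preserving_involutions n"
      using restriction_pair_surj by (metis imageI)
  next
    fix p assume "p \<in> restriction_pair ` basis_preserving_involutions n"
    then show "p \<in> ?P" using restriction_pair_in by (elim imageE) (simp only:)
  qed
  then have "card (basis_preserving_involutions n) = card ?P"
    using card_image[OF inj_on_restriction_pair] by simp
  also have "\<dots> = (\<Sum>g\<in>T.fixing_involutions (\<ominus> \<one>). card (T.fixed_points g))"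
  proof (rule card_SigmaI)
    have fin: "finite T" using card_T by (intro card_ge_0_finite) simp
    then have "finite (T \<rightarrow>\<^sub>E T)" by (intro finite_PiE) auto
    then show "finite (T.fixing_involutions (\<ominus> \<one>))"
      by (rule finite_subset[rotated]) (auto simp: fixing_involutions_iff PiE_def)
    show "\<forall>g\<in>T.fixing_involutions (\<ominus> \<one>). finite (T.fixed_points g)" using fin by auto
  qed
  finally show ?thesis .
qed

end

theorem theorem3p2:
  fixes n :: nat
  assumes "n \<ge> 1"
  shows "real (card (basis_preserving_involutions n)) =
    (\<Sum>k = nat \<lceil>real n / 2\<rceil>..n.
      (\<Prod>j = 1..<k. (2 ^ n - 2 ^ j) / (2 ^ k - 2 ^ j)) *
      (\<Prod>j = 0..<n - k. 2 ^ k - 2 ^ j) * 2 ^ k)"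
proof -
  interpret cring "MC n" by (rule MC_cring)
  interpret multicomplex "MC n" n
    by unfold_locales (rule refl, rule assms)
  show ?thesis
    unfolding card_basis_preserving_involutions
  proof (rule T.sum_card_fixed_points)
    show "\<ominus>\<^bsub>MC n\<^esub> \<one>\<^bsub>MC n\<^esub> \<in> carrier (MC n\<lparr>carrier := T\<rparr>)"
      using T_minus[OF T_one] by simp
  qed (use card_T one_neq_minus_one in simp_all)
qed

end
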